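(* Let $X$ be a compact metrizable space without isolated points and of cardinality $|X|=\mathfrak{c}$ (the cardinality of the continuum), and let $f:X\to X$ be a transitive homeomorphism. Then every countable scattered order-type and the order-type $\eta$ of the rationals appear in $\Omega(X^2)$, i.e. each of them belongs to $\Omega_f(x,y)$ for some $(x,y)\in X^2$. More precisely: 1. There exists a comeagre set $\mathcal{M}\subseteq X^2$ such that, for every $(x,y)\in\mathcal{M}$, the family $\Omega_f(x,y)$ contains every countably infinite scattered order-type. 2. For every $x,y\in X$, there is a finite ordinal $K$ with $K\in\Omega_f(x,y)$ if and only if $y\in\mathcal{O}^+(x)$. 3. For every $x,y\in X$, $\eta\in\Omega_f(x,y)$.
   Context: Throughout, $\mathbb{N}$ denotes the positive integers, and $d$ is a metric on $X$ inducing its topology. For a homeomorphism $f$ of $X$ and $x\in X$, the orbit of $x$ is $\mathcal{O}(x)=\{f^k(x):k\in\mathbb{Z}\}$ and the forward orbit is $\mathcal{O}^+(x)=\{f^k(x):k\in\mathbb{N}\}$. The homeomorphism $f$ is transitive if there is a point $x\in X$ with $\overline{\mathcal{O}(x)}=X$. Chains. For $x,y\in X$ and $\varepsilon>0$, an $\varepsilon$-chain from $x$ to $y$ is a map $C:\{0,1,\dots,m\}\to X$, $m\in\mathbb{N}$, such that, writing $x_i=C(i)$, one has $x_0=x$, $x_m=y$ and $d(f(x_i),x_{i+1})<\varepsilon$ for all $i=0,\dots,m-1$. Its support is $\widehat{C}=\{x_0,\dots,x_m\}$. The chain is acyclic if $x_i\neq x_j$ for all distinct $i,j\in\{1,\dots,m-1\}$,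 and $x_i\neq x_0$ and $x_i\neq x_m$ for all $i\in\{1,\dots,m-1\}$ (the case $x_0=x_m$ is allowed). For $z,w\in\widehat{C}$, $z$ appears no later than $w$ in $C$ if $\min\{i: C(i)=z\}\le\min\{j: C(j)=w\}$. Order-compatible nested sequences. An order-compatible nested sequence from $x$ to $y$ is a sequence $\{C_n\}_{n\in\mathbb{N}}$ such that, for some sequence of positive reals $\varepsilon_n$ converging monotonically to $0$, each $C_n$ is an acyclic $\varepsilon_n$-chain from $x$ to $y$, $\widehat{C_n}\subseteq\widehat{C_{n+1}}$ for all $n$, and for every $n$ and all $z,w\in\widehat{C_n}\setminus\{x,y\}$, if $z$ appears no later than $w$ in $C_n$, then $z$ appears no later than $w$ in $C_{n+1}$. Emergent Order Spectrum. Given an order-compatible nested sequence $\{C_n\}$ from $x$ to $y$, let $C=\bigcup_n\widehat{C_n}\setminus\{x,y\}$, with the linear order $\le_\infty$ defined by: $z\le_\infty w$ iff $z=w$ or $z$ appears no later than $w$ in $C_n$ for every $n$ such that $z,w\in\widehat{C_n}$. Then $\Omega_f(x,y)$ (also written $\Omega(x,y)$) is the collection of all order-types of $(C,\le_\infty)$ obtained as $\{C_n\}$ ranges over all order-compatible nested sequences from $x$ to $y$. An order-type belongs to $\Omega(X^2)$ if it belongs to $\Omega_f(x,y)$ for some $(x,y)\in X^2$. The order-type of a poset is its class under order-isomorphism. A linear order is scattered if it contains no subset order-isomorphic to $\mathbb{Q}$. $\eta$ is the order-type of $\mathbb{Q}$ (the countable dense order without extrema). A finite ordinal $K$ (possibly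 $0$) is identified with the order-type of the linear order on $K$ elements. *)

theory Defs
  imports "HOL-Analysis.Analysis"
begin

text \<open>The ambient space is a type \<open>'a::metric_space\<close>; its \<open>dist\<close> is the chosen metric inducing
  the topology.\<close>

subsection \<open>Orbits and transitivity\<close>

definition int_iterate :: "('a \<Rightarrow> 'a) \<Rightarrow> int \<Rightarrow> 'a \<Rightarrow> 'a" where
  "int_iterate f k = (if 0 \<le> k then f ^^ nat k else inv f ^^ nat (- k))"

definition orbit :: "('a \<Rightarrow> 'a) \<Rightarrow> 'a \<Rightarrow> 'a set" where
  "orbit f x = {int_iterate f k x | k. True}"

text \<open>The forward orbit starts at exponent 1, so it contains \<open>x\<close> only if \<open>x\<close> is periodic.\<close>

definition forward_orbit :: "('a \<Rightarrow> 'a) \<Rightarrow> 'a \<Rightarrow> 'a set" where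
  "forward_orbit f x = {(f ^^ k) x | k. 1 \<le> k}"

definition transitive :: "('a::topological_space \<Rightarrow> 'a) \<Rightarrow> bool" where
  "transitive f \<longleftrightarrow> (\<exists>x. closure (orbit f x) = UNIV)"

subsection \<open>Comeagre sets\<close>

definition nowhere_dense :: "'a::topological_space set \<Rightarrow> bool" where
  "nowhere_dense S \<longleftrightarrow> interior (closure S) = {}"

definition meagre :: "'a::topological_space set \<Rightarrow> bool" where
  "meagre S \<longleftrightarrow> (\<exists>N :: nat \<Rightarrow> 'a set. (\<forall>n. nowhere_dense (N n)) \<and> S = (\<Union>n. N n))"

definition comeagre :: "'a::topological_space set \<Rightarrow> bool" where
  "comeagre S \<longleftrightarrow> meagre (- S)"

subsection \<open>Chains\<close>

text \<open>A map on \<open>{0,\<dots>,m}\<close> is given by \<open>m\<close> together with a function on all of \<open>nat\<close>;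
  none of the notions below depends on its values beyond \<open>m\<close>.\<close>

definition chain ::
  "('a::metric_space \<Rightarrow> 'a) \<Rightarrow> real \<Rightarrow> 'a \<Rightarrow> 'a \<Rightarrow> nat \<Rightarrow> (nat \<Rightarrow> 'a) \<Rightarrow> bool" where
  "chain f \<epsilon> x y m C \<longleftrightarrow>
     1 \<le> m \<and> C 0 = x \<and> C m = y \<and> (\<forall>i<m. dist (f (C i)) (C (Suc i)) < \<epsilon>)"

definition chain_support :: "nat \<Rightarrow> (nat \<Rightarrow> 'a) \<Rightarrow> 'a set" where
  "chain_support m C = C ` {0..m}"

definition acyclic_chain :: "nat \<Rightarrow> (nat \<Rightarrow> 'a) \<Rightarrow> bool" where
  "acyclic_chain m C \<longleftrightarrow>
     (\<forall>i\<in>{1..<m}. \<forall>j\<in>{1..<m}. i \<noteq> j \<longrightarrow> C i \<noteq> C j) \<and>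
     (\<forall>i\<in>{1..<m}. C i \<noteq> C 0 \<and> C i \<noteq> C m)"

text \<open>Only meaningful for \<open>z\<close> and \<open>w\<close> in the support of the chain.\<close>

definition no_later :: "nat \<Rightarrow> (nat \<Rightarrow> 'a) \<Rightarrow> 'a \<Rightarrow> 'a \<Rightarrow> bool" where
  "no_later m C z w \<longleftrightarrow>
     (LEAST i. i \<le> m \<and> C i = z) \<le> (LEAST j. j \<le> m \<and> C j = w)"

text \<open>The \<open>n\<close>-th chain of the sequence is \<open>C n\<close> on \<open>{0,\<dots>,m n}\<close>.\<close>

definition order_compatible_nested ::
  "('a::metric_space \<Rightarrow> 'a) \<Rightarrow> 'a \<Rightarrow> 'a \<Rightarrow> (nat \<Rightarrow> nat) \<Rightarrow> (nat \<Rightarrow> nat \<Rightarrow> 'a) \<Rightarrow> bool" where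
  "order_compatible_nested f x y m C \<longleftrightarrow>
     (\<exists>\<epsilon> :: nat \<Rightarrow> real. (\<forall>n. 0 < \<epsilon> n) \<and> decseq \<epsilon> \<and> \<epsilon> \<longlonglongrightarrow> 0 \<and>
        (\<forall>n. chain f (\<epsilon> n) x y (m n) (C n) \<and> acyclic_chain (m n) (C n))) \<and>
     (\<forall>n. chain_support (m n) (C n) \<subseteq> chain_support (m (Suc n)) (C (Suc n))) \<and>
     (\<forall>n. \<forall>z \<in> chain_support (m n) (C n) - {x, y}. \<forall>w \<in> chain_support (m n) (C n) - {x, y}.
        no_later (m n) (C n) z w \<longrightarrow> no_later (m (Suc n)) (C (Suc n)) z w)"

subsection \<open>Order-types\<close>

text \<open>An order is a reflexive relation \<open>r\<close> on the carrier \<open>Field r\<close>. The order-type of a countable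
  poset is the class of all relations on \<open>nat\<close> that are isomorphic to it. Every countable poset
  has an isomorphic copy on a subset of \<open>nat\<close>, so two countable posets have the same
  order-type iff they are isomorphic, and the countable order-types are exactly those of the
  form \<open>order_type r\<close> with \<open>r :: nat rel\<close>. Although \<^const>\<open>iso\<close> is introduced in the library for
  well-orders, it means order-isomorphism for arbitrary relations, by \<open>iso_iff2\<close>.\<close>

definition order_type :: "'b rel \<Rightarrow> nat rel set" where
  "order_type r = {s. \<exists>h. iso r s h}"

definition rat_order :: "rat rel" where
  "rat_order = {(p, q). p \<le> q}"

definition eta_type :: "nat rel set" where
  "eta_type = order_type rat_order"

definition finite_type :: "nat \<Rightarrow> nat rel set" where
  "finite_type K = order_type {(i :: nat, j). i \<le> j \<and> j < K}"

definition scattered :: "'b rel \<Rightarrow> bool" where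
  "scattered r \<longleftrightarrow> \<not> (\<exists>A h. A \<subseteq> Field r \<and> iso rat_order (Restr r A) h)"

subsection \<open>The emergent order spectrum\<close>

definition limit_carrier ::
  "'a \<Rightarrow> 'a \<Rightarrow> (nat \<Rightarrow> nat) \<Rightarrow> (nat \<Rightarrow> nat \<Rightarrow> 'a) \<Rightarrow> 'a set" where
  "limit_carrier x y m C = (\<Union>n. chain_support (m n) (C n)) - {x, y}"

definition limit_order ::
  "'a \<Rightarrow> 'a \<Rightarrow> (nat \<Rightarrow> nat) \<Rightarrow> (nat \<Rightarrow> nat \<Rightarrow> 'a) \<Rightarrow> 'a rel" where
  "limit_order x y m C =
     {(z, w). z \<in> limit_carrier x y m C \<and> w \<in> limit_carrier x y m C \<and>
        (z = w \<or> (\<forall>n. z \<in> chain_support (m n) (C n) \<and> w \<in> chain_support (m n) (C n) \<longrightarrow>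
                      no_later (m n) (C n) z w))}"

definition spectrum :: "('a::metric_space \<Rightarrow> 'a) \<Rightarrow> 'a \<Rightarrow> 'a \<Rightarrow> nat rel set set" where
  "spectrum f x y =
     {order_type (limit_order x y m C) | m C. order_compatible_nested f x y m C}"

definition total_spectrum :: "('a::metric_space \<Rightarrow> 'a) \<Rightarrow> nat rel set set" where
  "total_spectrum f = (\<Union>(x, y) \<in> UNIV. spectrum f x y)"

end

theory Submission
  imports Defs
begin

text \<open>A nested sequence of chains only inserts new points into the gaps of earlier chains, so it can be
prescribed by labels: if distinct points of \<open>X\<close> are attached to the elements of a countable linear order \<open>L\<close> with least label at
\<open>x\<close> and greatest label at \<open>y\<close>, and if for every \<open>\<epsilon> > 0\<close> any two labels are joined by an \<open>\<epsilon>\<close>-chain with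
increasing labels, then the order-type of \<open>L\<close> without its two ends belongs to \<open>\<Omega>(x, y)\<close>
(\<open>order_type_in_spectrum\<close>). It remains to find labellings, and these are obtained from the Baire category
theorem in the compact space of all functions from labels to \<open>X\<close> (\<open>generic_function_exists\<close>).

For \<open>\<eta>\<close>, a generic assignment of points to the rationals works. Transitivity gives an \<open>\<epsilon>\<close>-chain
between any two points, and by density of the order there are always enough labels whose points are
still free to carry it (\<open>dense_labelling_exists\<close>).

For a scattered order, consecutive labels must carry consecutive points of an orbit. Therefore the order
is cut into the classes of its finite condensation, each class is laid out along one orbit, and only one
point per class is chosen generically (\<open>scattered_labelling_exists\<close>). An infinite class is an infinite
piece of a dense orbit and so comes close to everything that is required; between two labels of
distinct classes there is such a class, or one of the two is itself infinite in the right direction,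
because otherwise the classes between them would be densely ordered and the order would contain a copy of
the rationals (\<open>rationals_embed\<close>). The classes of the two ends are carried by the orbits of \<open>x\<close> and
\<open>y\<close>, so these orbits are taken to be dense in both time directions and disjoint. The pairs with this property
form the comeagre set.

A finite limit order forces the chains to be true orbit segments as soon as \<open>\<epsilon>\<close> is small, and conversely
the shortest orbit segment from \<open>x\<close> to \<open>y\<close> is a constant nested sequence
(\<open>finite_type_imp_forward_orbit\<close>, \<open>forward_orbit_imp_finite_type\<close>). Finite types occur in the total
spectrum because an orbit that is dense in a space without isolated points is aperiodic.\<close>

section \<open>Chains labelled by a linear order\<close>

definition label_step ::
  "('a::metric_space \<Rightarrow> 'a) \<Rightarrow> 'l::linorder set \<Rightarrow> ('l \<Rightarrow> 'a) \<Rightarrow> real \<Rightarrow> 'l \<Rightarrow> 'l \<Rightarrow> bool" where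
  "label_step f L \<phi> \<epsilon> a b \<longleftrightarrow> a \<in> L \<and> b \<in> L \<and> a < b \<and> dist (f (\<phi> a)) (\<phi> b) < \<epsilon>"

text \<open>The limit order of a nested sequence of chains is prescribed by labelling points with a
linearly ordered set \<open>L\<close> whose least element \<open>lo\<close> and greatest element \<open>hi\<close> stand for the two
endpoints. The last clause is the only dynamical one: between any two labels there are, for every
\<open>\<epsilon>\<close>, finitely many further labels whose points, read in increasing order, form an \<open>\<epsilon>\<close>-chain. The
points of \<open>lo\<close> and \<open>hi\<close> may coincide, since a chain may return to its starting point.\<close>
definition chain_labelling ::
  "('a::metric_space \<Rightarrow> 'a) \<Rightarrow> 'l::linorder set \<Rightarrow> 'l \<Rightarrow> 'l \<Rightarrow> ('l \<Rightarrow> 'a) \<Rightarrow> bool" where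
  "chain_labelling f L lo hi \<phi> \<longleftrightarrow>
     lo \<in> L \<and> hi \<in> L \<and> lo < hi \<and> L \<subseteq> {lo..hi} \<and>
     (\<forall>a\<in>L - {lo, hi}. \<forall>b\<in>L. a \<noteq> b \<longrightarrow> \<phi> a \<noteq> \<phi> b) \<and>
     (\<forall>\<epsilon>>0. \<forall>a\<in>L. \<forall>b\<in>L. a < b \<longrightarrow> (label_step f L \<phi> \<epsilon>)\<^sup>+\<^sup>+ a b)"

text \<open>A fine set is a finite set of labels that gives an \<open>\<epsilon>\<close>-chain when it is listed in increasing
order.\<close>
definition fine_set ::
  "('a::metric_space \<Rightarrow> 'a) \<Rightarrow> ('l::linorder \<Rightarrow> 'a) \<Rightarrow> real \<Rightarrow> 'l set \<Rightarrow> bool" where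
  "fine_set f \<phi> \<epsilon> F \<longleftrightarrow> finite F \<and>
     (\<forall>a\<in>F. \<forall>b\<in>F. a < b \<and> F \<inter> {a<..<b} = {} \<longrightarrow> dist (f (\<phi> a)) (\<phi> b) < \<epsilon>)"

lemma fine_set_glue:
  assumes "fine_set f \<phi> \<epsilon> F" "fine_set f \<phi> \<epsilon> G" "c \<in> F" "c \<in> G" "F \<subseteq> {..c}" "G \<subseteq> {c..}"
  shows "fine_set f \<phi> \<epsilon> (F \<union> G)"
  unfolding fine_set_def
proof (intro conjI ballI impI)
  show "finite (F \<union> G)" using assms by (simp add: fine_set_def)
next
  fix a b assume ab: "a \<in> F \<union> G" "b \<in> F \<union> G" "a < b \<and> (F \<union> G) \<inter> {a<..<b} = {}"
  have "(a \<in> F \<and> b \<in> F) \<or> (a \<in> G \<and> b \<in> G)"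
  proof (rule ccontr)
    assume not: "\<not> ?thesis"
    have le: "p \<le> c" if "p \<in> F" for p using that assms(5) by blast
    have ge: "c \<le> p" if "p \<in> G" for p using that assms(6) by blast
    have "\<not> (a \<in> G \<and> b \<in> F)" using le[of b] ge[of a] ab by auto
    with not ab have "a \<in> F" "b \<in> G" by auto
    then have "a \<le> c" "c \<le> b" using le ge by auto
    moreover have "a \<noteq> c" "b \<noteq> c" using not ab assms by auto
    ultimately have "c \<in> {a<..<b}" by auto
    then show False using ab assms(3) by blast
  qed
  then show "dist (f (\<phi> a)) (\<phi> b) < \<epsilon>"
    using ab assms(1,2) unfolding fine_set_def by (elim disjE) blast+
qed

lemma fine_set_pair: "dist (f (\<phi> a)) (\<phi> b) < \<epsilon> \<Longrightarrow> a < b \<Longrightarrow> fine_set f \<phi> \<epsilon> {a, b}"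
  by (auto simp: fine_set_def)

lemma fine_set_between:
  assumes "(label_step f L \<phi> \<epsilon>)\<^sup>+\<^sup>+ a b"
  shows "a < b \<and> (\<exists>F. fine_set f \<phi> \<epsilon> F \<and> a \<in> F \<and> b \<in> F \<and> F \<subseteq> L \<inter> {a..b})"
  using assms
proof (induction rule: tranclp_induct)
  case (base b)
  then show ?case
    by (intro conjI exI[of _ "{a, b}"]) (auto simp: label_step_def intro!: fine_set_pair)
next
  case (step b c)
  from step.IH obtain F where F: "fine_set f \<phi> \<epsilon> F" "a \<in> F" "b \<in> F" "F \<subseteq> L \<inter> {a..b}" and "a < b"
    by blast
  have bc: "b \<in> L" "c \<in> L" "b < c" "dist (f (\<phi> b)) (\<phi> c) < \<epsilon>"
    using step.hyps(2) by (auto simp: label_step_def)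
  have "fine_set f \<phi> \<epsilon> (F \<union> {b, c})"
    by (rule fine_set_glue[where c = b]) (use F bc in \<open>auto intro!: fine_set_pair\<close>)
  moreover have "F \<union> {b, c} \<subseteq> L \<inter> {a..c}" using F bc \<open>a < b\<close> by fastforce
  ultimately show ?case using F(2) \<open>a < b\<close> bc(3) by (intro conjI exI[of _ "F \<union> {b, c}"]) auto
qed

text \<open>Splice fine sets into the finitely many gaps of \<open>F\<close>, adding the elements of \<open>F\<close> from below. The bound
on the elements of \<open>G\<close> keeps each piece below the next one, so that they can be glued.\<close>
lemma fine_set_refinement:
  assumes "\<And>a b. a \<in> L \<Longrightarrow> b \<in> L \<Longrightarrow> a < b \<Longrightarrow> (label_step f L \<phi> \<epsilon>)\<^sup>+\<^sup>+ a b"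
    and "finite F" "F \<subseteq> L"
  shows "\<exists>G. fine_set f \<phi> \<epsilon> G \<and> F \<subseteq> G \<and> G \<subseteq> L \<and> (\<forall>g\<in>G. \<exists>a\<in>F. g \<le> a)"
  using assms(2,3)
proof (induction F rule: finite_linorder_max_induct)
  case empty
  then show ?case by (intro exI[of _ "{}"]) (auto simp: fine_set_def)
next
  case (insert b F)
  then obtain G where G: "fine_set f \<phi> \<epsilon> G" "F \<subseteq> G" "G \<subseteq> L" "\<forall>g\<in>G. \<exists>a\<in>F. g \<le> a" by auto
  show ?case
  proof (cases "F = {}")
    case True
    then show ?thesis
      using insert.prems by (intro exI[of _ "{b}"]) (auto simp: fine_set_def)
  next
    case False
    define c where "c = Max F"
    have c: "c \<in> F" "\<And>a. a \<in> F \<Longrightarrow> a \<le> c" using False insert.hyps(1) by (auto simp: c_def)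
    have "(label_step f L \<phi> \<epsilon>)\<^sup>+\<^sup>+ c b" using assms(1) c insert by auto
    then obtain H where H: "fine_set f \<phi> \<epsilon> H" "c \<in> H" "b \<in> H" "H \<subseteq> L \<inter> {c..b}"
      using fine_set_between by blast
    have "fine_set f \<phi> \<epsilon> (G \<union> H)"
    proof (rule fine_set_glue)
      show "G \<subseteq> {..c}" using G(4) c(2) by (auto intro: order_trans)
    qed (use G H c in auto)
    moreover have "\<forall>g\<in>G \<union> H. \<exists>a\<in>insert b F. g \<le> a" using G H by fastforce
    ultimately show ?thesis using G H by (intro exI[of _ "G \<union> H"]) auto
  qed
qed

definition set_chain :: "('l::linorder \<Rightarrow> 'a) \<Rightarrow> 'l set \<Rightarrow> nat \<Rightarrow> 'a" where
  "set_chain \<phi> F i = \<phi> (sorted_list_of_set F ! i)"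

lemma sorted_list_of_set_nth:
  fixes F :: "'l::linorder set"
  assumes "finite F" and "lo \<in> F" "hi \<in> F" "F \<subseteq> {lo..hi}"
  defines "e \<equiv> (!) (sorted_list_of_set F)" and "m \<equiv> card F - 1"
  shows "\<And>i j. i \<le> m \<Longrightarrow> j \<le> m \<Longrightarrow> e i < e j \<longleftrightarrow> i < j"
    and "e ` {0..m} = F" "e 0 = lo" "e m = hi"
    and "\<And>i. i < m \<Longrightarrow> F \<inter> {e i<..<e (Suc i)} = {}"
proof -
  have card: "card F = Suc m" using assms(1,2) card_gt_0_iff[of F] by (auto simp: m_def)
  have less: "e i < e j" if "i < j" "j \<le> m" for i j
    using sorted_wrt_nth_less[OF strict_sorted_list_of_set[of F], of i j] that card
    by (simp add: e_def)
  show iff: "\<And>i j. i \<le> m \<Longrightarrow> j \<le> m \<Longrightarrow> e i < e j \<longleftrightarrow> i < j"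
    by (metis less less_asym linorder_neqE_nat order_less_irrefl)
  have "F = set (sorted_list_of_set F)" using assms(1) by simp
  also have "\<dots> = e ` {0..m}"
    unfolding e_def set_conv_nth using card by (auto simp: image_iff less_Suc_eq_le)
  finally show img: "e ` {0..m} = F" ..
  have le: "lo \<le> e i \<and> e i \<le> hi" if "i \<le> m" for i using img assms(4) that by force
  obtain i where i: "i \<le> m" "e i = lo" using img assms(2) by force
  show "e 0 = lo" using le[of 0] less[of 0 i] i by (cases "i = 0") auto
  obtain j where j: "j \<le> m" "e j = hi" using img assms(3) by force
  show "e m = hi" using le[of m] less[of j m] j by (cases "j = m") auto
  show "F \<inter> {e i<..<e (Suc i)} = {}" if "i < m" for i
  proof (rule ccontr)
    assume "F \<inter> {e i<..<e (Suc i)} \<noteq> {}"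
    then obtain k where "k \<le> m" "e i < e k" "e k < e (Suc i)" unfolding img[symmetric] by auto
    then show False using iff that by auto
  qed
qed

text \<open>Only the endpoints can be visited twice, so an inner point of the chain has a unique position, and
positions are compared exactly as labels are.\<close>
lemma set_chain_properties:
  assumes lab: "chain_labelling f L lo hi \<phi>" and fine: "fine_set f \<phi> \<epsilon> F"
    and F: "lo \<in> F" "hi \<in> F" "F \<subseteq> L"
  defines "m \<equiv> card F - 1" and "C \<equiv> set_chain \<phi> F"
  shows "chain f \<epsilon> (\<phi> lo) (\<phi> hi) m C" "acyclic_chain m C" "chain_support m C = \<phi> ` F"
    and "\<And>a b. a \<in> F - {lo, hi} \<Longrightarrow> b \<in> F - {lo, hi} \<Longrightarrow> no_later m C (\<phi> a) (\<phi> b) \<longleftrightarrow> a \<le> b"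
proof -
  define e where "e = (!) (sorted_list_of_set F)"
  have C: "C i = \<phi> (e i)" for i by (simp add: C_def set_chain_def e_def)
  have fin: "finite F" using fine by (simp add: fine_set_def)
  have inj: "\<phi> a \<noteq> \<phi> b" if "a \<in> L - {lo, hi}" "b \<in> L" "a \<noteq> b" for a b
    using lab that unfolding chain_labelling_def by blast
  have lohi: "lo < hi" "F \<subseteq> {lo..hi}" using lab F by (auto simp: chain_labelling_def)
  note e = sorted_list_of_set_nth[OF fin F(1,2) lohi(2), folded e_def m_def]
  have eF: "e i \<in> F" if "i \<le> m" for i using e(2) that by auto
  have m1: "1 \<le> m" using e(3,4) lohi(1) by (cases m) auto
  have e_eq: "e i = e j \<longleftrightarrow> i = j" if "i \<le> m" "j \<le> m" for i j
    using e(1)[OF that] e(1)[OF that(2,1)] by (metis less_irrefl linorder_neqE_nat)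
  show "chain f \<epsilon> (\<phi> lo) (\<phi> hi) m C"
    unfolding chain_def
  proof (intro conjI allI impI)
    fix i assume i: "i < m"
    then have "e i < e (Suc i)" "e i \<in> F" "e (Suc i) \<in> F" using e(1) eF by auto
    then show "dist (f (C i)) (C (Suc i)) < \<epsilon>"
      unfolding C using fine e(5)[OF i] by (auto simp: fine_set_def)
  qed (use m1 C e in auto)
  have interior: "e i \<in> L - {lo, hi}" if "i \<in> {1..<m}" for i
    using that e_eq[of i 0] e_eq[of i m] eF[of i] F(3) e(3,4) by auto
  show "acyclic_chain m C"
    unfolding acyclic_chain_def C using e_eq eF F(3) interior
    by (intro conjI ballI impI inj) (auto simp: subset_iff)
  show "chain_support m C = \<phi> ` F"
    unfolding chain_support_def e(2)[symmetric] C image_image ..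
  have least: "(LEAST i. i \<le> m \<and> C i = \<phi> (e k)) = k" if k: "k \<le> m" "e k \<notin> {lo, hi}" for k
  proof -
    have "i = k" if "i \<le> m" "C i = \<phi> (e k)" for i
    proof (rule ccontr)
      assume "i \<noteq> k"
      then have "\<phi> (e k) \<noteq> \<phi> (e i)" using that k F(3) eF[of i] eF[of k] e_eq[of i k]
        by (intro inj) (simp_all add: subset_iff)
      then show False using that by (simp add: C)
    qed
    then show ?thesis using k by (intro Least_equality) (auto simp: C)
  qed
  fix a b assume a: "a \<in> F - {lo, hi}" and b: "b \<in> F - {lo, hi}"
  obtain i j where ij: "i \<le> m" "a = e i" "j \<le> m" "b = e j" using a b e(2) by force
  then show "no_later m C (\<phi> a) (\<phi> b) \<longleftrightarrow> a \<le> b"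
    unfolding no_later_def using least[of i] least[of j] a b e(1)[of j i] by auto
qed

lemma order_type_cong:
  assumes "iso r r' h"
  shows "order_type r = order_type r'"
proof -
  have h: "bij_betw h (Field r) (Field r')"
    "\<And>a b. a \<in> Field r \<Longrightarrow> b \<in> Field r \<Longrightarrow> (a, b) \<in> r \<longleftrightarrow> (h a, h b) \<in> r'"
    using assms by (auto simp: iso_iff2)
  let ?g = "inv_into (Field r) h"
  have g: "bij_betw ?g (Field r') (Field r)" using h(1) by (rule bij_betw_inv_into)
  have "iso r' r ?g"
    unfolding iso_iff2
  proof (intro conjI ballI g)
    fix a b assume "a \<in> Field r'" "b \<in> Field r'"
    then show "(a, b) \<in> r' \<longleftrightarrow> (?g a, ?g b) \<in> r"
      using h g bij_betw_inv_into_right[OF h(1)] by (auto simp: bij_betw_apply)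
  qed
  then have "(\<exists>k. iso r s k) \<longleftrightarrow> (\<exists>k. iso r' s k)" for s
    using comp_iso[OF assms] comp_iso[of r' r ?g] by (metis (full_types))
  then show ?thesis unfolding order_type_def by (intro Collect_cong)
qed

text \<open>Enumerate \<open>L\<close> and build increasing fine sets \<open>F n\<close> for the errors \<open>1/(n+1)\<close>, where \<open>F (n+1)\<close> contains
the \<open>n\<close>-th label. All of them are listed in the order of \<open>L\<close>, hence the chains are nested and
order-compatible, and the union exhausts \<open>L\<close>; so the limit order is that of \<open>L\<close> without its two
ends.\<close>
theorem order_type_in_spectrum:
  fixes L :: "'l::linorder set" and r :: "'i rel"
  assumes "countable L" and lab: "chain_labelling f L lo hi \<phi>"
    and e: "bij_betw e (Field r) (L - {lo, hi})"
    and er: "\<And>i j. i \<in> Field r \<Longrightarrow> j \<in> Field r \<Longrightarrow> (i, j) \<in> r \<longleftrightarrow> e i \<le> e j"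
  shows "order_type r \<in> spectrum f (\<phi> lo) (\<phi> hi)"
proof -
  have L: "lo \<in> L" "hi \<in> L" and "lo < hi" using lab by (auto simp: chain_labelling_def)
  have inj: "\<phi> a \<noteq> \<phi> b" if "a \<in> L - {lo, hi}" "b \<in> L" "a \<noteq> b" for a b
    using lab that unfolding chain_labelling_def by blast
  have steps: "(label_step f L \<phi> \<epsilon>)\<^sup>+\<^sup>+ a b" if "0 < \<epsilon>" "a \<in> L" "b \<in> L" "a < b" for \<epsilon> a b
    using lab that unfolding chain_labelling_def by blast
  define \<epsilon> :: "nat \<Rightarrow> real" where "\<epsilon> n = 1 / real (Suc n)" for n
  have "\<exists>F. \<forall>n. (fine_set f \<phi> (\<epsilon> n) (F n) \<and> {lo, hi} \<subseteq> F n \<and> F n \<subseteq> L) \<and>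
              insert (from_nat_into L n) (F n) \<subseteq> F (Suc n)"
  proof (rule dependent_nat_choice)
    show "\<exists>F. fine_set f \<phi> (\<epsilon> 0) F \<and> {lo, hi} \<subseteq> F \<and> F \<subseteq> L"
      using fine_set_refinement[OF steps, of "\<epsilon> 0" "{lo, hi}"] L by (auto simp: \<epsilon>_def)
  next
    fix F n assume F: "fine_set f \<phi> (\<epsilon> n) F \<and> {lo, hi} \<subseteq> F \<and> F \<subseteq> L"
    then have "finite F" by (simp add: fine_set_def)
    moreover have "from_nat_into L n \<in> L" using L by (intro from_nat_into) auto
    moreover have "0 < \<epsilon> (Suc n)" by (simp add: \<epsilon>_def)
    ultimately obtain G where "fine_set f \<phi> (\<epsilon> (Suc n)) G" "insert (from_nat_into L n) F \<subseteq> G" "G \<subseteq> L"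
      using fine_set_refinement[OF steps, of "\<epsilon> (Suc n)" "insert (from_nat_into L n) F"] F by auto
    then show "\<exists>G. (fine_set f \<phi> (\<epsilon> (Suc n)) G \<and> {lo, hi} \<subseteq> G \<and> G \<subseteq> L) \<and>
        insert (from_nat_into L n) F \<subseteq> G"
      using F by blast
  qed
  then obtain F where F_all: "\<forall>n. (fine_set f \<phi> (\<epsilon> n) (F n) \<and> {lo, hi} \<subseteq> F n \<and> F n \<subseteq> L) \<and>
      insert (from_nat_into L n) (F n) \<subseteq> F (Suc n)" ..
  have fine: "fine_set f \<phi> (\<epsilon> n) (F n)"
    and F: "lo \<in> F n" "hi \<in> F n" "F n \<subseteq> L"
    and F_Suc: "from_nat_into L n \<in> F (Suc n)" "F n \<subseteq> F (Suc n)" for n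
    using F_all[rule_format, of n] by simp_all
  have UF: "(\<Union>n. F n) = L"
  proof
    show "L \<subseteq> (\<Union>n. F n)"
    proof
      fix a assume "a \<in> L"
      then obtain n where "a = from_nat_into L n" using assms(1) by (metis from_nat_into_surj)
      then show "a \<in> (\<Union>n. F n)" using F_Suc(1) by blast
    qed
  qed (use F in auto)
  define m where "m n = card (F n) - 1" for n
  define C where "C n = set_chain \<phi> (F n)" for n
  note props = set_chain_properties[OF lab fine F(1) F(2) F(3), folded m_def C_def]
  define I where "I = L - {lo, hi}"
  have img: "\<phi> ` A - {\<phi> lo, \<phi> hi} = \<phi> ` (A - {lo, hi})" if "A \<subseteq> L" for A
    using inj L that by fastforce
  have ocn: "order_compatible_nested f (\<phi> lo) (\<phi> hi) m C"
    unfolding order_compatible_nested_def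
  proof (intro conjI allI)
    have "\<epsilon> \<longlonglongrightarrow> 0" unfolding \<epsilon>_def by (rule LIMSEQ_Suc[OF lim_1_over_n])
    moreover have "decseq \<epsilon>" by (auto simp: decseq_def \<epsilon>_def frac_le)
    ultimately show "\<exists>\<epsilon>. (\<forall>n. 0 < \<epsilon> n) \<and> decseq \<epsilon> \<and> \<epsilon> \<longlonglongrightarrow> 0 \<and>
        (\<forall>n. chain f (\<epsilon> n) (\<phi> lo) (\<phi> hi) (m n) (C n) \<and> acyclic_chain (m n) (C n))"
      using props(1,2) by (intro exI[of _ \<epsilon>]) (auto simp: \<epsilon>_def)
    show "chain_support (m n) (C n) \<subseteq> chain_support (m (Suc n)) (C (Suc n))" for n
      using F_Suc(2) by (auto simp: props(3))
    show "\<forall>z\<in>chain_support (m n) (C n) - {\<phi> lo, \<phi> hi}.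
          \<forall>w\<in>chain_support (m n) (C n) - {\<phi> lo, \<phi> hi}.
          no_later (m n) (C n) z w \<longrightarrow> no_later (m (Suc n)) (C (Suc n)) z w" for n
      unfolding props(3) img[OF F(3)] using props(4) F_Suc(2)[of n] by auto
  qed
  have carrier: "limit_carrier (\<phi> lo) (\<phi> hi) m C = \<phi> ` I"
    unfolding limit_carrier_def props(3) image_UN[symmetric] UF I_def by (rule img) simp
  have mono: "F n \<subseteq> F n'" if "n \<le> n'" for n n'
    using lift_Suc_mono_le[of F, OF F_Suc(2) that] .
  have both: "\<exists>n. a \<in> F n \<and> b \<in> F n" if "a \<in> L" "b \<in> L" for a b
  proof -
    obtain n n' where "a \<in> F n" "b \<in> F n'" using \<open>a \<in> L\<close> \<open>b \<in> L\<close> UF by blast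
    then show ?thesis using mono[of n "max n n'"] mono[of n' "max n n'"] by auto
  qed
  have mem: "\<phi> a \<in> \<phi> ` F n \<longleftrightarrow> a \<in> F n" if "a \<in> I" for a n
    using inj[of a] that F(3)[of n] unfolding I_def by blast
  have order: "(\<phi> a, \<phi> b) \<in> limit_order (\<phi> lo) (\<phi> hi) m C \<longleftrightarrow> a \<le> b" if "a \<in> I" "b \<in> I" for a b
  proof -
    have "no_later (m n) (C n) (\<phi> a) (\<phi> b) \<longleftrightarrow> a \<le> b" if "a \<in> F n" "b \<in> F n" for n
      using props(4) \<open>a \<in> I\<close> \<open>b \<in> I\<close> that by (auto simp: I_def)
    moreover have "\<phi> a = \<phi> b \<longleftrightarrow> a = b" using inj that by (auto simp: I_def)
    ultimately show ?thesis
      unfolding limit_order_def carrier props(3)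
      using that both[of a b] by (auto simp: mem I_def)
  qed
  let ?R = "limit_order (\<phi> lo) (\<phi> hi) m C"
  have Field: "Field ?R = \<phi> ` I"
    using carrier by (auto simp: Field_def limit_order_def)
  have "inj_on \<phi> I" using inj unfolding I_def inj_on_def by blast
  then have bij: "bij_betw (\<phi> \<circ> e) (Field r) (Field ?R)"
    using e unfolding Field I_def by (intro bij_betw_trans) (auto simp: bij_betw_def)
  have "iso r ?R (\<phi> \<circ> e)"
    unfolding iso_iff2
  proof (intro conjI ballI bij)
    fix a b assume ab: "a \<in> Field r" "b \<in> Field r"
    then have "e a \<in> I" "e b \<in> I" using e by (auto simp: I_def bij_betw_def)
    then show "(a, b) \<in> r \<longleftrightarrow> ((\<phi> \<circ> e) a, (\<phi> \<circ> e) b) \<in> ?R"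
      using order er ab by auto
  qed
  then have "order_type r = order_type ?R" by (rule order_type_cong)
  then show ?thesis unfolding spectrum_def using ocn by auto
qed

section \<open>Generic points in compact spaces\<close>

lemma Baire_compact_Hausdorff:
  assumes "compact_space X" "Hausdorff_space X" "topspace X \<noteq> {}" "countable \<G>"
    and "\<And>G. G \<in> \<G> \<Longrightarrow> openin X G \<and> X closure_of G = topspace X"
  shows "\<exists>x. \<forall>G\<in>\<G>. x \<in> G"
proof -
  have "X closure_of \<Inter>\<G> = topspace X"
    using assms by (intro Baire_category)
      (auto simp: compact_imp_locally_compact_space compact_Hausdorff_imp_regular_space)
  then have "\<Inter>\<G> \<noteq> {}" using assms(3) by (metis closure_of_empty)
  then show ?thesis by blast
qed

lemma generic_point_exists:
  fixes \<G> :: "'b::t2_space set set"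
  assumes "compact (UNIV :: 'b set)" "countable \<G>"
    and "\<And>G. G \<in> \<G> \<Longrightarrow> open G \<and> closure G = UNIV"
  shows "\<exists>x. \<forall>G\<in>\<G>. x \<in> G"
  using assms by (intro Baire_compact_Hausdorff[where X = euclidean])
    (auto simp: compact_space_def Hausdorff_space_def separation_t2 disjnt_def)

text \<open>The family of all functions into a compact space is compact and Hausdorff, so the Baire category
theorem yields one function that meets countably many open conditions at once. Density of a condition
in the product topology means that finitely many values can be kept up to an arbitrarily small
error.\<close>
lemma generic_function_exists:
  fixes \<G> :: "('i \<Rightarrow> 'a::metric_space) set set"
  assumes "compact (UNIV :: 'a set)" "countable \<G>" and "\<And>G. G \<in> \<G> \<Longrightarrow> open G"
    and dense: "\<And>G z I e. G \<in> \<G> \<Longrightarrow> finite I \<Longrightarrow> 0 < e \<Longrightarrow> \<exists>w\<in>G. \<forall>i\<in>I. dist (w i) (z i) < (e :: real)"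
  shows "\<exists>z. \<forall>G\<in>\<G>. z \<in> G"
proof (rule Baire_compact_Hausdorff[where X = "product_topology (\<lambda>_. euclidean) UNIV"])
  let ?X = "product_topology (\<lambda>_ :: 'i. euclidean :: 'a topology) UNIV"
  have "compact_space (euclidean :: 'a topology)" using assms(1) by (simp add: compact_space_def)
  then show "compact_space ?X" by (simp only: compact_space_product_topology) simp
  show "Hausdorff_space ?X" by (simp add: Hausdorff_space_product_topology Hausdorff_space_euclidean)
  show "topspace ?X \<noteq> {}" by simp
  fix G assume G: "G \<in> \<G>"
  have "z \<in> ?X closure_of G" for z
    unfolding in_closure_of
  proof (intro conjI allI impI)
    fix W assume "z \<in> W \<and> openin ?X W"
    then obtain U where U: "finite {i. U i \<noteq> UNIV}" "\<And>i. open (U i)" "z \<in> Pi\<^sub>E UNIV U" "Pi\<^sub>E UNIV U \<subseteq> W"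
      unfolding openin_product_topology_alt by force
    have "\<exists>e>0. ball (z i) e \<subseteq> U i" for i
      using U(2)[of i] U(3) open_contains_ball by (metis PiE_mem UNIV_I)
    then obtain e where e: "\<And>i. 0 < e i" "\<And>i. ball (z i) (e i) \<subseteq> U i" by metis
    define d where "d = Min (insert 1 (e ` {i. U i \<noteq> UNIV}))"
    have "0 < d" using U(1) e(1) by (auto simp: d_def)
    then obtain w where w: "w \<in> G" "\<And>i. U i \<noteq> UNIV \<Longrightarrow> dist (w i) (z i) < d"
      using dense[OF G U(1), of d z] by auto
    have "w i \<in> U i" for i
    proof (cases "U i = UNIV")
      case False
      then have "d \<le> e i" using U(1) by (auto simp: d_def intro!: Min_le)
      then have "w i \<in> ball (z i) (e i)" using w(2)[OF False] by (simp add: dist_commute)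
      then show ?thesis using e(2) by blast
    qed simp
    then have "w \<in> Pi\<^sub>E UNIV U" by (simp add: PiE_iff)
    then show "\<exists>y. y \<in> G \<and> y \<in> W" using w(1) U(4) by blast
  qed simp
  then show "openin ?X G \<and> ?X closure_of G = topspace ?X"
    using assms(3)[OF G] by (auto simp: open_fun_def)
qed (rule assms(2))

lemma comeagre_Inter:
  assumes "countable \<G>" "\<And>G. G \<in> \<G> \<Longrightarrow> open G \<and> closure G = UNIV"
  shows "comeagre (\<Inter>\<G>)"
proof -
  let ?N = "\<lambda>n. - from_nat_into (insert UNIV \<G>) n"
  have "range (from_nat_into (insert UNIV \<G>)) = insert UNIV \<G>"
    using assms(1) by (intro range_from_nat_into) auto
  then have "- \<Inter>\<G> = (\<Union>n. ?N n)" by (metis Compl_INT Inter_insert inf_top_left)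
  moreover have "nowhere_dense (?N n)" for n
  proof -
    have "from_nat_into (insert UNIV \<G>) n \<in> insert UNIV \<G>" by (intro from_nat_into) simp
    then have "open (from_nat_into (insert UNIV \<G>) n) \<and> closure (from_nat_into (insert UNIV \<G>) n) = UNIV"
      using assms(2) by auto
    then show ?thesis
      unfolding nowhere_dense_def by (simp add: closure_closed closed_Compl interior_complement)
  qed
  ultimately show ?thesis unfolding comeagre_def meagre_def by metis
qed

section \<open>Orbits of a transitive homeomorphism\<close>

locale transitive_system =
  fixes f :: "'a::metric_space \<Rightarrow> 'a"
  assumes compact_UNIV: "compact (UNIV :: 'a set)"
    and perfect: "\<not> open {x :: 'a}"
    and homeo: "homeomorphism UNIV UNIV f (inv f)"
    and transitive: "transitive f"
begin

abbreviation iter :: "int \<Rightarrow> 'a \<Rightarrow> 'a" where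
  "iter \<equiv> int_iterate f"

lemma f_inv [simp]: "f (inv f x) = x" and inv_f [simp]: "inv f (f x) = x"
  using homeo by (auto simp: homeomorphism_def)

lemma f_eq_iff [simp]: "f x = f y \<longleftrightarrow> x = y"
  by (metis inv_f)

lemma iter_0 [simp]: "iter 0 x = x"
  by (simp add: int_iterate_def)

lemma iter_of_nat: "iter (int n) x = (f ^^ n) x"
  by (simp add: int_iterate_def)

lemma iter_Suc: "iter (k + 1) x = f (iter k x)"
proof (cases "0 \<le> k")
  case True
  then show ?thesis by (simp add: int_iterate_def nat_add_distrib)
next
  case False
  define n where "n = nat (- k - 1)"
  have "nat (- k) = Suc n" "nat (- (k + 1)) = n" using False by (simp_all add: n_def)
  moreover have "f ((inv f ^^ Suc n) x) = (inv f ^^ n) x" by simp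
  moreover have "n = 0" if "0 \<le> k + 1" using False that by (simp add: n_def)
  ultimately show ?thesis using False by (auto simp: int_iterate_def simp del: funpow.simps)
qed

lemma iter_add: "iter (j + k) x = iter j (iter k x)"
proof (induction j rule: int_induct[where k = 0])
  case (step1 j)
  have "iter (j + 1 + k) x = f (iter (j + k) x)" using iter_Suc[of "j + k" x] by (simp add: add_ac)
  then show ?case using step1 iter_Suc[of j "iter k x"] by simp
next
  case (step2 j)
  have "f (iter (j - 1 + k) x) = f (iter (j - 1) (iter k x))"
    using step2 iter_Suc[of "j - 1 + k" x] iter_Suc[of "j - 1" "iter k x"] by (simp add: algebra_simps)
  then show ?case by simp
qed simp

lemma iter_cancel [simp]: "iter (- k) (iter k x) = x" "iter k (iter (- k) x) = x"
  by (simp_all flip: iter_add)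

lemma iter_eq_iff: "iter i x = iter j y \<longleftrightarrow> x = iter (j - i) y"
proof -
  have "iter i x = iter j y \<longleftrightarrow> iter (- i) (iter i x) = iter (- i) (iter j y)"
    by (metis iter_cancel(2))
  then show ?thesis by (simp flip: iter_add add: algebra_simps)
qed

lemma continuous_f: "continuous_on UNIV f"
  and continuous_inv: "continuous_on UNIV (inv f)"
  using homeo by (auto simp: homeomorphism_def)

lemma continuous_funpow:
  assumes "continuous_on UNIV (g :: 'a \<Rightarrow> 'a)"
  shows "continuous_on UNIV (g ^^ n)"
proof (induction n)
  case (Suc n)
  then show ?case using continuous_on_compose2[OF assms Suc] by (simp add: comp_def)
qed (simp add: id_def)

lemma continuous_iter: "continuous_on UNIV (iter k)"
  using continuous_funpow[OF continuous_f] continuous_funpow[OF continuous_inv]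
  by (auto simp: int_iterate_def)

lemma continuous_iter_compose [continuous_intros]:
  "continuous_on S g \<Longrightarrow> continuous_on S (\<lambda>x. iter k (g x))"
  by (rule continuous_on_compose2[OF continuous_iter]) auto

lemma continuous_f_compose [continuous_intros]:
  "continuous_on S g \<Longrightarrow> continuous_on S (\<lambda>x. f (g x))"
  by (rule continuous_on_compose2[OF continuous_f]) auto

lemma infinite_open:
  assumes "open U" "U \<noteq> {}"
  shows "infinite (U :: 'a set)"
proof
  assume "finite U"
  obtain x where "x \<in> U" using assms by blast
  have "open (U - (U - {x}))" using \<open>finite U\<close> assms(1) by (intro open_Diff finite_imp_closed) auto
  moreover have "U - (U - {x}) = {x}" using \<open>x \<in> U\<close> by auto
  ultimately show False using perfect by auto
qed

lemma open_avoid_finite: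
  assumes "open U" "U \<noteq> {}" "finite F"
  shows "\<exists>x :: 'a. x \<in> U - F"
  using infinite_open[OF assms(1,2)] assms(3) by (metis Diff_infinite_finite ex_in_conv finite.emptyI)

lemma dense_orbit: "\<exists>x. \<forall>U. open U \<and> U \<noteq> {} \<longrightarrow> (\<exists>k. iter k x \<in> U)"
proof -
  obtain x where "closure (orbit f x) = UNIV" using transitive by (auto simp: transitive_def)
  then have "U \<inter> orbit f x \<noteq> {}" if "open U" "U \<noteq> {}" for U
    using open_Int_closure_eq_empty[OF \<open>open U\<close>, of "orbit f x"] that by auto
  then show ?thesis unfolding orbit_def by blast
qed

text \<open>If the dense orbit visits \<open>U\<close> at time \<open>i\<close> and \<open>V\<close> at time \<open>j\<close>, then the points of \<open>U\<close> that lie in \<open>V\<close>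
after \<open>j - i\<close> steps form a nonempty open set \<open>W\<close>. There are no isolated points, so the dense orbit
visits \<open>W\<close> at infinitely many times; two of them, far enough apart, give a passage from \<open>U\<close> to \<open>V\<close>
that is as long as desired.\<close>
lemma recurrence:
  fixes N :: int
  assumes "open U" "U \<noteq> {}" "open V" "V \<noteq> {}"
  shows "\<exists>x\<in>U. \<exists>k\<ge>N. iter k x \<in> V"
proof -
  obtain x where x: "\<And>U. open U \<Longrightarrow> U \<noteq> {} \<Longrightarrow> \<exists>k. iter k x \<in> U" using dense_orbit by blast
  obtain i j where ij: "iter i x \<in> U" "iter j x \<in> V" using x[OF assms(1,2)] x[OF assms(3,4)] by blast
  define n where "n = j - i"
  define W where "W = U \<inter> iter n -` V"
  have "open W" unfolding W_def using assms continuous_iter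
    by (intro open_Int open_vimage) auto
  moreover have "iter i x \<in> W" using ij by (simp add: W_def n_def flip: iter_add)
  ultimately have W: "open W" "W \<noteq> {}" by auto
  define T where "T = {t. iter t x \<in> W}"
  have "infinite T"
  proof
    assume "finite T"
    let ?F = "(\<lambda>t. iter t x) ` T"
    have "open (W - ?F)" using W(1) \<open>finite T\<close> by (intro open_Diff finite_imp_closed) auto
    moreover have "W - ?F \<noteq> {}" using open_avoid_finite[OF W, of ?F] \<open>finite T\<close> by blast
    ultimately obtain k where "iter k x \<in> W - ?F" using x by blast
    then show False by (auto simp: T_def)
  qed
  then obtain t where "t \<in> T" by (metis ex_in_conv finite.emptyI)
  define M where "M = \<bar>N - n\<bar>"
  have "\<not> T \<subseteq> {t - M..t + M}" using \<open>infinite T\<close> finite_subset by blast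
  then obtain s where "s \<in> T" "s < t - M \<or> t + M < s" by force
  then obtain t1 t2 where t12: "t1 \<in> T" "t2 \<in> T" "t1 + M < t2"
  proof (elim disjE)
    assume "s < t - M" then show ?thesis using that[of s t] \<open>s \<in> T\<close> \<open>t \<in> T\<close> by simp
  next
    assume "t + M < s" then show ?thesis using that[of t s] \<open>s \<in> T\<close> \<open>t \<in> T\<close> by simp
  qed
  have "iter (t2 + n - t1) (iter t1 x) = iter n (iter t2 x)"
    by (simp add: algebra_simps flip: iter_add)
  then have "iter (t2 + n - t1) (iter t1 x) \<in> V" using t12(2) by (simp add: T_def W_def)
  moreover have "N \<le> t2 + n - t1" using t12(3) by (simp add: M_def)
  moreover have "iter t1 x \<in> U" using t12(1) by (simp add: T_def W_def)
  ultimately show ?thesis by blast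
qed

text \<open>Any two points are joined by an \<open>\<epsilon>\<close>-chain that follows a true orbit except for its first and its last
jump.\<close>
lemma chain_link:
  assumes "0 < \<epsilon>"
  shows "\<exists>w n. dist (f p) w < \<epsilon> \<and> dist ((f ^^ Suc n) w) q < \<epsilon>"
proof -
  obtain w k where w: "w \<in> ball (f p) \<epsilon>" "1 \<le> k" "iter k w \<in> ball q \<epsilon>"
    using recurrence[of "ball (f p) \<epsilon>" "ball q \<epsilon>" 1] assms by auto
  then have "k = int (Suc (nat (k - 1)))" by simp
  then have "iter k w = (f ^^ Suc (nat (k - 1))) w" by (metis iter_of_nat)
  then show ?thesis using w by (intro exI[of _ w] exI[of _ "nat (k - 1)"]) (simp add: dist_commute)
qed

definition bitransitive :: "'a \<Rightarrow> bool" where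
  "bitransitive z \<longleftrightarrow> (\<forall>U N. open U \<and> U \<noteq> {} \<longrightarrow> (\<exists>k\<ge>N. iter k z \<in> U) \<and> (\<exists>k\<le>N. iter k z \<in> U))"

lemma bitransitive_aperiodic:
  assumes "bitransitive z" "iter k z = z"
  shows "k = 0"
proof (rule ccontr)
  assume "k \<noteq> 0"
  have mult: "iter (k * m) z = z" for m
  proof (induction m rule: int_induct[where k = 0])
    case (step1 m)
    then show ?case using assms(2) by (simp add: distrib_left iter_add)
  next
    case (step2 m)
    have "iter (- k) z = z" using assms(2) iter_cancel(1)[of k z] by simp
    then show ?case using step2 iter_add[of "- k" "k * m" z] by (simp add: algebra_simps)
  qed simp
  define F where "F = (\<lambda>j. iter j z) ` {-\<bar>k\<bar>..\<bar>k\<bar>}"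
  have "open (- F)" unfolding F_def by (intro open_Compl finite_imp_closed) auto
  moreover have "- F \<noteq> {}"
    using open_avoid_finite[of UNIV F] by (auto simp: F_def)
  ultimately obtain j where "iter j z \<in> - F" using assms(1) by (auto simp: bitransitive_def)
  moreover have "iter j z = iter (j mod k) z"
    using mult[of "j div k"] iter_add[of "j mod k" "k * (j div k)" z] by simp
  moreover have "j mod k \<in> {-\<bar>k\<bar>..\<bar>k\<bar>}"
    using \<open>k \<noteq> 0\<close> abs_mod_less[of k j] by auto
  ultimately show False unfolding F_def by blast
qed

text \<open>A countable base is supplied by the balls of radius \<open>1/(n+1)\<close> around the points of a dense orbit.\<close>
lemma bitransitive_generic:
  "\<exists>\<G>. countable \<G> \<and> (\<forall>G\<in>\<G>. open G \<and> closure G = UNIV) \<and> {z. bitransitive z} = \<Inter>\<G>"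
proof -
  obtain x where x: "\<And>U. open U \<Longrightarrow> U \<noteq> {} \<Longrightarrow> \<exists>k. iter k x \<in> U" using dense_orbit by blast
  define B where "B i n = ball (iter i x) (1 / real (Suc n))" for i n
  define S where "S N b = (if b then {N..} else {..N :: int})" for N b
  define G where "G = (\<lambda>(i, n, N, b). \<Union>k\<in>S N b. iter k -` B i n)"
  have B: "open (B i n)" "B i n \<noteq> {}" for i n by (auto simp: B_def)
  have S: "S N True = {N..}" "S N False = {..N}" for N by (auto simp: S_def)
  have fine: "\<exists>i n. B i n \<subseteq> U" if U: "open U" "U \<noteq> {}" for U
  proof -
    obtain y e where y: "0 < e" "ball y e \<subseteq> U" using U by (metis ex_in_conv openE)
    obtain i where i: "iter i x \<in> ball y (e / 2)" using x[of "ball y (e / 2)"] y(1) by auto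
    obtain n where n: "1 / real (Suc n) < e / 2"
      using y(1) nat_approx_posE[of "e / 2"] by auto
    have "B i n \<subseteq> ball y e"
    proof
      fix w assume "w \<in> B i n"
      then have "dist (iter i x) w < e / 2" using n by (simp add: B_def)
      moreover have "dist y (iter i x) < e / 2" using i by simp
      ultimately show "w \<in> ball y e" using dist_triangle[of y w "iter i x"] by simp
    qed
    then show ?thesis using y(2) by blast
  qed
  have "open (G p)" for p
    unfolding G_def by (cases p) (auto intro!: open_UN open_vimage B continuous_iter)
  moreover have "closure (G p) = UNIV" for p
  proof -
    obtain i n N b where p: "p = (i, n, N, b)" by (cases p)
    have "V \<inter> G p \<noteq> {}" if V: "open V" "V \<noteq> {}" for V
    proof (cases b)
      case True
      then show ?thesis
        using recurrence[OF V B(1)[of i n] B(2), of N] by (auto simp: G_def p S)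
    next
      case False
      obtain y k where y: "y \<in> B i n" "- N \<le> k" "iter k y \<in> V"
        using recurrence[OF B(1)[of i n] B(2) V, of "- N"] by blast
      then have "iter (- k) (iter k y) \<in> B i n" "- k \<in> {..N}" by auto
      then have "iter k y \<in> G p" using False unfolding G_def p by (auto simp: S simp del: iter_cancel)
      then show ?thesis using y by blast
    qed
    then have "- closure (G p) = {}"
      by (metis Compl_disjoint2 closed_closure open_Compl open_Int_closure_eq_empty)
    then show ?thesis by auto
  qed
  moreover have "{z. bitransitive z} = \<Inter>(range G)"
  proof (intro set_eqI iffI)
    fix z assume z: "z \<in> {z. bitransitive z}"
    have "z \<in> G (i, n, N, b)" for i n N b
      using z B[of i n] by (cases b) (auto simp: bitransitive_def G_def S)
    then show "z \<in> \<Inter>(range G)" by auto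
  next
    fix z assume z: "z \<in> \<Inter>(range G)"
    have "(\<exists>k\<ge>N. iter k z \<in> U) \<and> (\<exists>k\<le>N. iter k z \<in> U)" if U: "open U" "U \<noteq> {}" for U N
    proof -
      obtain i n where "B i n \<subseteq> U" using fine U by blast
      moreover have "z \<in> G (i, n, N, True)" "z \<in> G (i, n, N, False)" using z by auto
      ultimately show ?thesis unfolding G_def by (auto simp: S)
    qed
    then show "z \<in> {z. bitransitive z}" by (auto simp: bitransitive_def)
  qed
  ultimately show ?thesis by (intro exI[of _ "range G"]) auto
qed

text \<open>For these endpoints, both halves of the two orbits are dense, and the orbits are disjoint. This is
what a scattered order demands: its chains may have to follow the forward orbit of \<open>x\<close> or the
backward orbit of \<open>y\<close> exactly.\<close>
definition generic_pairs :: "('a \<times> 'a) set" where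
  "generic_pairs = {(x, y). bitransitive x \<and> bitransitive y \<and> (\<forall>k. y \<noteq> iter k x)}"

lemma generic_pairs:
  "\<exists>\<G>. countable \<G> \<and> (\<forall>G\<in>\<G>. open G \<and> closure G = UNIV) \<and> generic_pairs = \<Inter>\<G>"
proof -
  obtain \<G> where \<G>: "countable \<G>" "\<And>G. G \<in> \<G> \<Longrightarrow> open G \<and> closure G = UNIV"
    "{z. bitransitive z} = \<Inter>\<G>" using bitransitive_generic by blast
  define D where "D k = {p :: 'a \<times> 'a. snd p \<noteq> iter k (fst p)}" for k
  define \<H> where "\<H> = (\<lambda>G. G \<times> UNIV) ` \<G> \<union> (\<lambda>G. UNIV \<times> G) ` \<G> \<union> range D"
  have "open (D k)" for k
    unfolding D_def by (intro open_Collect_neq continuous_intros)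
  moreover have "closure (D k) = UNIV" for k
  proof -
    have "W \<inter> D k \<noteq> {}" if W: "open W" "W \<noteq> {}" for W
    proof -
      obtain x y where "(x, y) \<in> W" using W by auto
      then obtain A B where AB: "open A" "open B" "x \<in> A" "y \<in> B" "A \<times> B \<subseteq> W"
        using W(1) by (metis open_prod_elim mem_Sigma_iff)
      then obtain y' where "y' \<in> B - {iter k x}" using open_avoid_finite[of B "{iter k x}"] by auto
      then have "(x, y') \<in> W \<inter> D k" using AB by (auto simp: D_def)
      then show ?thesis by blast
    qed
    then have "- closure (D k) = {}"
      by (metis Compl_disjoint2 closed_closure open_Compl open_Int_closure_eq_empty)
    then show ?thesis by auto
  qed
  ultimately have "\<forall>H\<in>\<H>. open H \<and> closure H = UNIV"
    using \<G>(2) by (auto simp: \<H>_def closure_Times open_Times)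
  moreover have "countable \<H>" using \<G>(1) by (simp add: \<H>_def)
  moreover have "generic_pairs = \<Inter>\<H>"
  proof -
    have "bitransitive z \<longleftrightarrow> (\<forall>G\<in>\<G>. z \<in> G)" for z using \<G>(3) by blast
    then have "(x, y) \<in> generic_pairs \<longleftrightarrow> (x, y) \<in> \<Inter>\<H>" for x y
      by (simp add: generic_pairs_def \<H>_def D_def ball_Un conj_assoc)
    then show ?thesis by (simp add: set_eq_iff)
  qed
  ultimately show ?thesis by blast
qed

lemma comeagre_generic_pairs: "comeagre generic_pairs"
  using generic_pairs comeagre_Inter by metis

lemma generic_pairs_nonempty: "generic_pairs \<noteq> {}"
proof -
  have "compact (UNIV :: ('a \<times> 'a) set)"
    using compact_Times[OF compact_UNIV compact_UNIV] by simp
  then show ?thesis using generic_pairs generic_point_exists by (metis Inter_iff empty_iff)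
qed

end

section \<open>The finite condensation of a linear order\<close>

text \<open>Two elements of \<open>L\<close> with only finitely many elements between them lie in the same class of the
finite condensation. A class is order-isomorphic to a finite order, \<open>\<omega>\<close>, its reverse, or \<open>\<int>\<close>. Since
consecutive points of the limit order are eventually consecutive in all chains, a whole class has to
be laid out along a single orbit.\<close>
definition near :: "'l::linorder set \<Rightarrow> 'l \<Rightarrow> 'l \<Rightarrow> bool" where
  "near L a b \<longleftrightarrow> finite (L \<inter> {min a b..max a b})"

definition succ_in :: "'l::linorder set \<Rightarrow> 'l \<Rightarrow> 'l \<Rightarrow> bool" where
  "succ_in L a b \<longleftrightarrow> a \<in> L \<and> b \<in> L \<and> a < b \<and> L \<inter> {a<..<b} = {}"

text \<open>These two properties depend only on the class of \<open>a\<close>. They tell in which directions the orbit segment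
carrying that class is infinite.\<close>
definition no_last :: "'l::linorder set \<Rightarrow> 'l \<Rightarrow> bool" where
  "no_last L a \<longleftrightarrow> (\<forall>u\<in>L. near L a u \<longrightarrow> (\<exists>v\<in>L. near L a v \<and> u < v))"

definition no_first :: "'l::linorder set \<Rightarrow> 'l \<Rightarrow> bool" where
  "no_first L a \<longleftrightarrow> (\<forall>u\<in>L. near L a u \<longrightarrow> (\<exists>v\<in>L. near L a v \<and> v < u))"

lemma near_refl [simp]: "near L a a"
proof -
  have "L \<inter> {a..a} \<subseteq> {a}" by auto
  then show ?thesis unfolding near_def by (simp add: finite_subset)
qed

lemma near_le: "a \<le> b \<Longrightarrow> near L a b \<longleftrightarrow> finite (L \<inter> {a..b})"
  by (simp add: near_def min_absorb1 max_absorb2)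

lemma near_sym: "near L a b \<longleftrightarrow> near L b a"
  by (simp add: near_def min.commute max.commute)

lemma near_trans:
  assumes "near L a b" "near L b c"
  shows "near L a c"
proof -
  have "L \<inter> {min a c..max a c} \<subseteq> L \<inter> {min a b..max a b} \<union> L \<inter> {min b c..max b c}"
    by (auto simp: min_def max_def split: if_splits)
  then show ?thesis using assms unfolding near_def by (meson finite_UnI finite_subset)
qed

lemma near_subinterval:
  assumes "near L a b" "a \<le> c" "c \<le> d" "d \<le> b"
  shows "near L c d"
proof -
  have "L \<inter> {min c d..max c d} \<subseteq> L \<inter> {min a b..max a b}"
    using assms(2-4) by (auto simp: min_def max_def)
  then show ?thesis using assms(1) unfolding near_def by (rule finite_subset)
qed

lemma no_last_cong: "near L a b \<Longrightarrow> no_last L a \<longleftrightarrow> no_last L b"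
  unfolding no_last_def by (metis near_sym near_trans)

lemma no_first_cong: "near L a b \<Longrightarrow> no_first L a \<longleftrightarrow> no_first L b"
  unfolding no_first_def by (metis near_sym near_trans)

lemma succ_in_near:
  assumes "succ_in L a b"
  shows "near L a b"
proof -
  have "a < b" "L \<inter> {a..b} \<subseteq> {a, b}" using assms by (auto simp: succ_in_def set_eq_iff less_le)
  then show ?thesis by (simp add: near_le finite_subset)
qed

lemma near_succ_path:
  assumes "a \<in> L" "b \<in> L" "a < b" "near L a b"
  shows "(succ_in L)\<^sup>+\<^sup>+ a b"
  using assms
proof (induction "card (L \<inter> {a..b})" arbitrary: a b rule: less_induct)
  case less
  have fin: "finite (L \<inter> {a..b})" using less.prems by (simp add: near_le)
  show ?case
  proof (cases "L \<inter> {a<..<b} = {}")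
    case True
    then show ?thesis using less.prems by (intro tranclp.r_into_trancl) (simp add: succ_in_def)
  next
    case False
    then obtain c where c: "c \<in> L" "a < c" "c < b" by auto
    have "L \<inter> {a..c} \<subset> L \<inter> {a..b}" "L \<inter> {c..b} \<subset> L \<inter> {a..b}"
    proof -
      have "L \<inter> {a..c} \<subseteq> L \<inter> {a..b}" "L \<inter> {c..b} \<subseteq> L \<inter> {a..b}" using c by auto
      moreover have "b \<notin> L \<inter> {a..c}" "a \<notin> L \<inter> {c..b}" "a \<in> L \<inter> {a..b}" "b \<in> L \<inter> {a..b}"
        using c less.prems by auto
      ultimately show "L \<inter> {a..c} \<subset> L \<inter> {a..b}" "L \<inter> {c..b} \<subset> L \<inter> {a..b}" by blast+
    qed
    then have card: "card (L \<inter> {a..c}) < card (L \<inter> {a..b})" "card (L \<inter> {c..b}) < card (L \<inter> {a..b})"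
      using fin by (auto intro: psubset_card_mono)
    have "near L a c" "near L c b"
      using near_subinterval[OF less.prems(4), of a c] near_subinterval[OF less.prems(4), of c b] c
      by auto
    then show ?thesis
      using less.hyps[OF card(1)] less.hyps[OF card(2)] less.prems c by (meson tranclp_trans)
  qed
qed

lemma succ_exists:
  assumes "a \<in> L" "v \<in> L" "a < v" "near L a v"
  shows "\<exists>s. succ_in L a s \<and> near L a s"
proof -
  have "(succ_in L)\<^sup>+\<^sup>+ a v" using near_succ_path assms .
  then obtain s where "succ_in L a s" by (metis tranclpD)
  then show ?thesis using succ_in_near by blast
qed

lemma pred_exists:
  assumes "v \<in> L" "a \<in> L" "v < a" "near L v a"
  shows "\<exists>p. succ_in L p a \<and> near L p a"
proof -
  have "(succ_in L)\<^sup>+\<^sup>+ v a" using near_succ_path assms .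
  then obtain p where "succ_in L p a" by (metis tranclp.cases)
  then show ?thesis using succ_in_near by blast
qed

text \<open>Positions within the classes: the number of elements from the representative \<open>rep a\<close> up to \<open>a\<close>, with
a sign. One of the two cardinalities below is always zero.\<close>
lemma class_offsets:
  fixes L :: "'l::linorder set"
  assumes rep: "\<And>a. a \<in> L \<Longrightarrow> near L a (rep a)"
    and rep_eq: "\<And>a b. a \<in> L \<Longrightarrow> b \<in> L \<Longrightarrow> near L a b \<Longrightarrow> rep a = rep b"
  shows "\<exists>off :: 'l \<Rightarrow> int. (\<forall>a. rep a = a \<longrightarrow> off a = 0) \<and> (\<forall>a b. succ_in L a b \<longrightarrow> off b = off a + 1)"
proof -
  define off where "off a = int (card (L \<inter> {rep a<..a})) - int (card (L \<inter> {a<..rep a}))" for a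
  have "off b = off a + 1" if ab: "succ_in L a b" for a b
  proof -
    have L: "a \<in> L" "b \<in> L" "a < b" and gap: "\<And>c. c \<in> L \<Longrightarrow> a < c \<Longrightarrow> c < b \<Longrightarrow> False"
      using ab by (auto simp: succ_in_def)
    have gap': "c \<le> a \<or> b \<le> c" if "c \<in> L" for c using gap[OF that] by fastforce
    have eq: "rep b = rep a" using rep_eq L succ_in_near[OF ab] by metis
    show ?thesis
    proof (cases "rep a \<le> a")
      case True
      then have "finite (L \<inter> {rep a..a})" using rep[OF L(1)] by (simp add: near_sym[of L a] near_le)
      then have "finite (L \<inter> {rep a<..a})" by (rule rev_finite_subset) auto
      moreover have "L \<inter> {rep a<..b} = insert b (L \<inter> {rep a<..a})"
        using True L by (auto dest: gap')
      moreover have "L \<inter> {a<..rep a} = {}" "L \<inter> {b<..rep a} = {}" using True L by auto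
      moreover have "b \<notin> L \<inter> {rep a<..a}" using L by auto
      ultimately show ?thesis by (simp add: off_def eq)
    next
      case False
      show ?thesis
      proof (cases "rep a < b")
        case True
        have "L \<inter> {rep a<..b} = {b}" using True False L gap by force
        moreover have "L \<inter> {rep a<..a} = {}" "L \<inter> {b<..rep a} = {}" using True False by auto
        moreover have "L \<inter> {a<..rep a} = {}" using True gap by force
        ultimately show ?thesis by (simp add: off_def eq)
      next
        case rb: False
        have "finite (L \<inter> {a..rep a})" using rep[OF L(1)] False by (simp add: near_le)
        then have "finite (L \<inter> {b<..rep a})" by (rule rev_finite_subset) (use L in auto)
        moreover have "L \<inter> {a<..rep a} = insert b (L \<inter> {b<..rep a})"
          using rb L by (fastforce dest: gap')
        moreover have "L \<inter> {rep a<..b} = {}" "L \<inter> {rep a<..a} = {}" using rb False by auto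
        ultimately show ?thesis by (simp add: off_def eq)
      qed
    qed
  qed
  moreover have "off a = 0" if "rep a = a" for a using that by (simp add: off_def)
  ultimately show ?thesis by blast
qed

lemma off_strict_mono:
  fixes off :: "'l::linorder \<Rightarrow> int"
  assumes off: "\<And>a b. succ_in L a b \<Longrightarrow> off b = off a + 1"
    and "a \<in> L" "b \<in> L" "a < b" "near L a b"
  shows "off a < off b"
  using near_succ_path[OF assms(2-5)]
  by (induction rule: tranclp_induct) (auto dest: off)

text \<open>All classes strictly between those of \<open>a\<close> and \<open>b\<close> are finite, the class of \<open>a\<close> has a last element, and
that of \<open>b\<close> a first one. If two of these classes are distinct, then the last element of
the lower one and the first element of the higher one still have infinitely many elements between
them, so the classes are densely ordered. Hence the rationals can be placed one after another, in
pairwise different classes.\<close>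
lemma rationals_embed:
  fixes L :: "'l::linorder set"
  assumes ab: "a \<in> L" "b \<in> L" "a < b" "\<not> near L a b" "\<not> no_last L a" "\<not> no_first L b"
    and between: "\<And>c. c \<in> L \<Longrightarrow> a < c \<Longrightarrow> c < b \<Longrightarrow> \<not> near L a c \<Longrightarrow> \<not> near L c b \<Longrightarrow>
      \<not> no_last L c \<and> \<not> no_first L c"
  shows "\<exists>e :: rat \<Rightarrow> 'l. strict_mono e \<and> range e \<subseteq> L"
proof -
  define far where "far c d \<longleftrightarrow> c < d \<and> \<not> near L c d" for c d
  define P where "P = {c \<in> L. far a c \<and> far c b}"
  have far_mono: "far c d" if "far c' d'" "c \<le> c'" "d' \<le> d" for c d c' d'
    using that near_subinterval[of L c d c' d'] unfolding far_def by (auto intro: less_imp_le)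
  have dense: "\<exists>w\<in>P. far u w \<and> far w v"
    if uv: "u \<in> insert a P" "v \<in> insert b P" "far u v" for u v
  proof -
    have L: "u \<in> L" "v \<in> L" using uv ab by (auto simp: P_def)
    have "\<not> no_last L u" "\<not> no_first L v" using uv ab between by (auto simp: P_def far_def)
    then obtain u' v' where u': "u' \<in> L" "near L u u'" "\<And>w. w \<in> L \<Longrightarrow> near L u w \<Longrightarrow> w \<le> u'"
      and v': "v' \<in> L" "near L v v'" "\<And>w. w \<in> L \<Longrightarrow> near L v w \<Longrightarrow> v' \<le> w"
      unfolding no_last_def no_first_def by (metis leI)
    have not: "\<not> near L u' v'" using uv(3) u'(2) v'(2) unfolding far_def by (metis near_sym near_trans)
    have "u \<le> u'" "v' \<le> v" using u'(3)[OF L(1)] v'(3)[OF L(2)] by auto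
    have "u' < v'"
    proof (rule ccontr)
      assume "\<not> u' < v'"
      then have "v' \<le> u'" by simp
      show False
      proof (cases "v \<le> u'")
        case True
        then have "near L u v" using near_subinterval[OF u'(2) order_refl _ True] uv(3)
            unfolding far_def by (blast intro: less_imp_le)
        then show False using uv(3) by (simp add: far_def)
      next
        case False
        then have "near L v' u'" using near_subinterval[of L v' v v' u'] v'(2) \<open>v' \<le> u'\<close>
          by (simp add: near_sym)
        then show False using not by (simp add: near_sym)
      qed
    qed
    then have "infinite (L \<inter> {u'..v'})" using not by (simp add: near_le)
    then have "infinite (L \<inter> {u'..v'} - {u', v'})" by simp
    then obtain w where "w \<in> L \<inter> {u'..v'} - {u', v'}" by (metis ex_in_conv finite.emptyI)
    then have w: "w \<in> L" "u' < w" "w < v'" by auto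
    have "far u w" "far w v"
      using w u'(3)[of w] v'(3)[of w] \<open>u \<le> u'\<close> \<open>v' \<le> v\<close> unfolding far_def by (auto simp: near_sym)
    moreover have "a \<le> u" "v \<le> b" using uv by (auto simp: P_def far_def)
    ultimately have "far a w" "far w b" using far_mono by blast+
    then show ?thesis using w(1) \<open>far u w\<close> \<open>far w v\<close> by (auto simp: P_def)
  qed
  define q :: "nat \<Rightarrow> rat" where "q = from_nat"
  \<comment> \<open>The relation \<open>Q g n c\<close> says that \<open>c\<close> is a correct place for the \<open>n\<close>-th rational, given the places \<open>g i\<close> of the earlier ones.\<close>
  define Q where "Q g n c \<longleftrightarrow> c \<in> P \<and> (\<forall>i<n. (q i < q n \<longrightarrow> far (g i) c) \<and> (q n < q i \<longrightarrow> far c (g i)))"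
    for g n c
  have "\<exists>g. \<forall>n. Q g n (g n)"
  proof (rule dependent_wellorder_choice)
    show "Q g n c = Q g' n c" if "\<And>i. i < n \<Longrightarrow> g i = g' i" for n c and g g' :: "nat \<Rightarrow> 'l"
      using that by (auto simp: Q_def)
  next
    fix n and g :: "nat \<Rightarrow> 'l" assume IH: "\<And>i. i < n \<Longrightarrow> Q g i (g i)"
    have P: "g i \<in> P" if "i < n" for i using IH[OF that] by (simp add: Q_def)
    have far_g: "far (g i) (g j)" if "i < n" "j < n" "q i < q j" for i j
      using IH[OF that(1)] IH[OF that(2)] that(3) by (cases i j rule: linorder_cases) (auto simp: Q_def)
    define U where "U = insert a (g ` {i. i < n \<and> q i < q n})"
    define V where "V = insert b (g ` {i. i < n \<and> q n < q i})"
    have fin: "finite U" "finite V" by (simp_all add: U_def V_def)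
    have "U \<noteq> {}" "V \<noteq> {}" by (simp_all add: U_def V_def)
    then have "Max U \<in> U" "Min V \<in> V" using fin by (simp_all add: Max_in Min_in)
    have "far u v" if "u \<in> U" "v \<in> V" for u v
    proof -
      have "far (g i) (g j)" if "i < n" "q i < q n" "j < n" "q n < q j" for i j
        using far_g[of i j] that by auto
      moreover have "far a (g i)" "far (g i) b" if "i < n" for i using P[OF that] by (auto simp: P_def)
      moreover have "far a b" using ab by (simp add: far_def)
      ultimately show ?thesis using that unfolding U_def V_def by blast
    qed
    moreover have "U \<subseteq> insert a P" "V \<subseteq> insert b P" using P by (auto simp: U_def V_def)
    ultimately obtain w where w: "w \<in> P" "far (Max U) w" "far w (Min V)"
      using dense[of "Max U" "Min V"] \<open>Max U \<in> U\<close> \<open>Min V \<in> V\<close> by blast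
    have "Q g n w"
      unfolding Q_def
    proof (intro conjI allI impI w(1))
      fix i assume "i < n" "q i < q n"
      then have "g i \<le> Max U" using fin by (intro Max_ge) (auto simp: U_def)
      then show "far (g i) w" using far_mono w(2) by blast
    next
      fix i assume "i < n" "q n < q i"
      then have "Min V \<le> g i" using fin by (intro Min_le) (auto simp: V_def)
      then show "far w (g i)" using far_mono w(3) by blast
    qed
    then show "\<exists>c. Q g n c" ..
  qed
  then obtain g where g: "\<And>n. Q g n (g n)" by blast
  define e :: "rat \<Rightarrow> 'l" where "e p = g (to_nat p)" for p
  have "e p < e p'" if "p < p'" for p p'
  proof -
    have "q (to_nat p) < q (to_nat p')" using that by (simp add: q_def)
    then have "far (e p) (e p')"
      using g[of "to_nat p"] g[of "to_nat p'"]
      by (cases "to_nat p" "to_nat p'" rule: linorder_cases) (auto simp: Q_def e_def)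
    then show ?thesis by (simp add: far_def)
  qed
  moreover have "e p \<in> L" for p using g[of "to_nat p"] by (simp add: Q_def P_def e_def)
  ultimately show ?thesis by (intro exI[of _ e]) (auto simp: strict_mono_def)
qed

section \<open>Labellings by dense orders\<close>

lemma tranclp_refine:
  assumes "r\<^sup>+\<^sup>+ a b" "\<And>c d. r c d \<Longrightarrow> s\<^sup>+\<^sup>+ c d"
  shows "s\<^sup>+\<^sup>+ a b"
  using assms(1) by (induction rule: tranclp_induct) (auto intro: assms(2) tranclp_trans)

lemma label_steps_mono:
  assumes "(label_step f L \<phi> \<delta>)\<^sup>+\<^sup>+ a b" "\<delta> \<le> \<epsilon>"
  shows "(label_step f L \<phi> \<epsilon>)\<^sup>+\<^sup>+ a b"
  using assms(1) by (rule tranclp_refine) (use assms(2) in \<open>auto simp: label_step_def intro!: tranclp.r_into_trancl\<close>)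

context transitive_system
begin

lemma open_label_steps:
  fixes \<phi> :: "'b::topological_space \<Rightarrow> 'l::linorder \<Rightarrow> 'a"
  assumes cont: "\<And>a. continuous_on UNIV (\<lambda>z. \<phi> z a)"
  shows "open {z. (label_step f L (\<phi> z) \<epsilon>)\<^sup>+\<^sup>+ a b}"
proof (subst open_subopen, intro ballI)
  have op: "open {z. label_step f L (\<phi> z) \<epsilon> c d}" for c d
  proof (cases "c \<in> L \<and> d \<in> L \<and> c < d")
    case True
    moreover have "open {z. dist (f (\<phi> z c)) (\<phi> z d) < \<epsilon>}"
      by (intro open_Collect_less continuous_intros cont)
    ultimately show ?thesis by (simp add: label_step_def)
  next
    case False
    then have "{z. label_step f L (\<phi> z) \<epsilon> c d} = {}" by (auto simp: label_step_def)
    then show ?thesis by simp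
  qed
  fix z assume "z \<in> {z. (label_step f L (\<phi> z) \<epsilon>)\<^sup>+\<^sup>+ a b}"
  then have "(label_step f L (\<phi> z) \<epsilon>)\<^sup>+\<^sup>+ a b" by simp
  then show "\<exists>T. open T \<and> z \<in> T \<and> T \<subseteq> {z. (label_step f L (\<phi> z) \<epsilon>)\<^sup>+\<^sup>+ a b}"
  proof (induction rule: tranclp_induct)
    case (base c)
    then show ?case using op[of a c] by (intro exI[of _ "{z. label_step f L (\<phi> z) \<epsilon> a c}"]) auto
  next
    case (step c d)
    then obtain T where T: "open T" "z \<in> T" "T \<subseteq> {z. (label_step f L (\<phi> z) \<epsilon>)\<^sup>+\<^sup>+ a c}" by blast
    have "open (T \<inter> {z. label_step f L (\<phi> z) \<epsilon> c d})" using T(1) op by auto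
    moreover have "T \<inter> {z. label_step f L (\<phi> z) \<epsilon> c d} \<subseteq> {z. (label_step f L (\<phi> z) \<epsilon>)\<^sup>+\<^sup>+ a d}"
      using T(3) by (auto intro: tranclp.trancl_into_trancl)
    ultimately show ?case using T(2) step.hyps(2) by blast
  qed
qed

lemma continuous_pinned:
  "continuous_on UNIV (\<lambda>z :: 'l \<Rightarrow> 'a. (z(lo := x, hi := y)) c)"
  by (cases "c = lo"; cases "c = hi") auto

text \<open>A link from \<open>\<psi> a\<close> to \<open>\<psi> b\<close> consists of \<open>n + 1\<close> orbit points. Each of them gets a new label between
the previous one and \<open>b\<close>; in a dense order such labels exist outside every finite set \<open>I\<close> of labels
whose points have to stay.\<close>
lemma fill_gap:
  fixes L :: "'l::linorder set"
  assumes dense: "\<And>a b. a \<in> L \<Longrightarrow> b \<in> L \<Longrightarrow> a < b \<Longrightarrow> infinite (L \<inter> {a<..<b})"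
    and "0 < \<epsilon>" and "a \<in> L" "b \<in> L" "a < b" "finite I" "a \<in> I" "b \<in> I"
    and "dist (f (\<psi> a)) w < \<epsilon>" "dist ((f ^^ Suc n) w) (\<psi> b) < \<epsilon>"
  shows "\<exists>\<psi>'. (\<forall>i\<in>I. \<psi>' i = \<psi> i) \<and> (label_step f L \<psi>' \<epsilon>)\<^sup>+\<^sup>+ a b"
  using assms(3-)
proof (induction n arbitrary: a I \<psi> w)
  have new: "\<exists>c. c \<in> L \<and> a < c \<and> c < b \<and> c \<notin> I" if "a \<in> L" "b \<in> L" "a < b" "finite I" for a I
  proof -
    have "infinite (L \<inter> {a<..<b} - I)" using dense that by simp
    then obtain c where "c \<in> L \<inter> {a<..<b} - I" by (metis ex_in_conv finite.emptyI)
    then show ?thesis by auto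
  qed
  {
    case 0
    obtain c where c: "c \<in> L" "a < c" "c < b" "c \<notin> I" using new[OF 0(1-4)] by blast
    let ?\<psi> = "\<psi>(c := w)"
    have "label_step f L ?\<psi> \<epsilon> a c" "label_step f L ?\<psi> \<epsilon> c b"
      using 0 c by (auto simp: label_step_def)
    then have "(label_step f L ?\<psi> \<epsilon>)\<^sup>+\<^sup>+ a b" by (metis tranclp.r_into_trancl tranclp.trancl_into_trancl)
    moreover have "\<forall>i\<in>I. ?\<psi> i = \<psi> i" using c(4) by auto
    ultimately show ?case by blast
  next
    case (Suc n)
    obtain c where c: "c \<in> L" "a < c" "c < b" "c \<notin> I" using new[OF Suc.prems(1-4)] by blast
    let ?\<psi> = "\<psi>(c := w)"
    have b: "?\<psi> b = \<psi> b" using c by auto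
    have "dist ((f ^^ Suc n) (f w)) (?\<psi> b) < \<epsilon>" using Suc.prems unfolding b by (simp add: funpow_swap1)
    moreover have "dist (f (?\<psi> c)) (f w) < \<epsilon>" using assms(2) by simp
    ultimately obtain \<psi>' where \<psi>': "\<forall>i\<in>insert c I. \<psi>' i = ?\<psi> i" "(label_step f L \<psi>' \<epsilon>)\<^sup>+\<^sup>+ c b"
      using Suc.IH[of c "insert c I" ?\<psi> "f w"] Suc.prems c by auto
    have "\<psi>' c = w" using \<psi>'(1) by simp
    moreover have "\<forall>i\<in>I. \<psi>' i = \<psi> i" using \<psi>'(1) c(4) by auto
    moreover from calculation have "label_step f L \<psi>' \<epsilon> a c"
      using Suc.prems c by (simp add: label_step_def)
    ultimately show ?case using \<psi>'(2) by (meson tranclp_into_tranclp2)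
  }
qed

text \<open>Over a dense order a generic assignment of points works for all endpoints \<open>x\<close> and \<open>y\<close>. Being joined
by labels of an \<open>\<epsilon>\<close>-chain is an open condition, and a dense one: an approximation fixes the points of
only finitely many labels, and the missing chain can be written on the others. Distinctness of points
is generic because there are no isolated points.\<close>
lemma dense_labelling_exists:
  fixes L :: "'l::linorder set"
  assumes "countable L" and L: "lo \<in> L" "hi \<in> L" "lo < hi" "L \<subseteq> {lo..hi}"
    and dense: "\<And>a b. a \<in> L \<Longrightarrow> b \<in> L \<Longrightarrow> a < b \<Longrightarrow> infinite (L \<inter> {a<..<b})"
  shows "\<exists>\<phi>. chain_labelling f L lo hi \<phi> \<and> \<phi> lo = x \<and> \<phi> hi = y"
proof -
  \<comment> \<open>The two endpoints are prescribed, so the conditions are imposed on the assignment with these two values overwritten.\<close>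
  define A where "A z = z(lo := x, hi := y)" for z :: "'l \<Rightarrow> 'a"
  have cont: "continuous_on UNIV (\<lambda>z. A z c)" for c
    unfolding A_def by (rule continuous_pinned)
  define D where "D = (\<lambda>(a, b). {z. A z a \<noteq> A z b})"
  define E where "E = (\<lambda>(a, b, n). {z. (label_step f L (A z) (1 / real (Suc n)))\<^sup>+\<^sup>+ a b})"
  define DI where "DI = {(a, b). a \<in> L - {lo, hi} \<and> b \<in> L \<and> a \<noteq> b}"
  define EI where "EI = {(a, b, n :: nat). a \<in> L \<and> b \<in> L \<and> a < b}"
  have "\<exists>z. \<forall>G\<in>D ` DI \<union> E ` EI. z \<in> G"
  proof (rule generic_function_exists[OF compact_UNIV])
    have "DI \<subseteq> L \<times> L" "EI \<subseteq> L \<times> L \<times> UNIV" by (auto simp: DI_def EI_def)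
    then show "countable (D ` DI \<union> E ` EI)"
      using assms(1) by (meson countable_SIGMA countable_Un countable_image countable_subset countableI_type)
  next
    have "open (D p)" for p
      unfolding D_def by (cases p) (auto intro!: open_Collect_neq cont)
    moreover have "open (E p)" for p
      unfolding E_def by (cases p) (auto intro!: open_label_steps cont)
    ultimately show "open G" if "G \<in> D ` DI \<union> E ` EI" for G using that by auto
  next
    fix G and z :: "'l \<Rightarrow> 'a" and I :: "'l set" and e :: real
    assume G: "G \<in> D ` DI \<union> E ` EI" and I: "finite I" and e: "0 < e"
    from G consider (D) a b where "(a, b) \<in> DI" "G = D (a, b)" | (E) a b n where "(a, b, n) \<in> EI" "G = E (a, b, n)"
      by (auto simp: DI_def EI_def)
    then show "\<exists>w\<in>G. \<forall>i\<in>I. dist (w i) (z i) < e"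
    proof cases
      case D
      obtain p where p: "p \<in> ball (z a) e - {A z b}"
        using open_avoid_finite[of "ball (z a) e" "{A z b}"] e by auto
      let ?w = "z(a := p)"
      have "A ?w a = p" "A ?w b = A z b" using D(1) by (auto simp: DI_def A_def)
      then have "?w \<in> G" using p D(2) by (simp add: D_def)
      moreover have "\<forall>i\<in>I. dist (?w i) (z i) < e" using p e by (simp add: dist_commute)
      ultimately show ?thesis by blast
    next
      case E
      then have ab: "a \<in> L" "b \<in> L" "a < b" by (auto simp: EI_def)
      have pos: "0 < 1 / real (Suc n)" by simp
      obtain w m where wm: "dist (f (A z a)) w < 1 / real (Suc n)"
        "dist ((f ^^ Suc m) w) (A z b) < 1 / real (Suc n)"
        using chain_link[OF pos] by blast
      obtain \<psi> where \<psi>: "\<forall>i\<in>I \<union> {a, b, lo, hi}. \<psi> i = A z i"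
        "(label_step f L \<psi> (1 / real (Suc n)))\<^sup>+\<^sup>+ a b"
        using fill_gap[OF dense pos ab _ _ _ wm, of "I \<union> {a, b, lo, hi}"] I by auto
      define v where "v = \<psi>(lo := z lo, hi := z hi)"
      have "A v = \<psi>" using \<psi>(1) L(3) by (auto simp: A_def v_def)
      then have "v \<in> G" using \<psi>(2) E(2) by (simp add: E_def)
      moreover have "v i = z i" if "i \<in> I" for i using \<psi>(1) that by (auto simp: A_def v_def)
      ultimately show ?thesis using e by (intro bexI[of _ v]) auto
    qed
  qed
  then obtain z where z: "\<forall>G\<in>D ` DI \<union> E ` EI. z \<in> G" ..
  have "(label_step f L (A z) \<epsilon>)\<^sup>+\<^sup>+ a b" if "0 < \<epsilon>" "a \<in> L" "b \<in> L" "a < b" for \<epsilon> a b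
  proof -
    obtain n where n: "1 / real (Suc n) < \<epsilon>" using nat_approx_posE \<open>0 < \<epsilon>\<close> by blast
    have "(a, b, n) \<in> EI" using that by (simp add: EI_def)
    then have "z \<in> E (a, b, n)" by (intro z[THEN bspec] UnI2 imageI)
    then show ?thesis using label_steps_mono n by (force simp: E_def)
  qed
  moreover have "A z a \<noteq> A z b" if "a \<in> L - {lo, hi}" "b \<in> L" "a \<noteq> b" for a b
  proof -
    have "(a, b) \<in> DI" using that by (simp add: DI_def)
    then have "z \<in> D (a, b)" by (intro z[THEN bspec] UnI1 imageI)
    then show ?thesis by (simp add: D_def)
  qed
  ultimately have "chain_labelling f L lo hi (A z)" using L by (simp add: chain_labelling_def)
  then show ?thesis using L(3) by (intro exI[of _ "A z"]) (auto simp: A_def)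
qed

end

section \<open>Labellings by scattered orders\<close>

context transitive_system
begin

text \<open>Choose one point \<open>z c\<close> for each class \<open>c\<close>, with \<open>x\<close> and \<open>y\<close> for the classes of the two ends, and lay
the class out along the orbit of \<open>z c\<close>; let \<open>z\<close> be generic otherwise. Labels of one class are joined by
a true orbit segment. A class without last element follows a dense forward orbit, so it comes close to
the preimage of any point, and its labels are joined to all later labels; a class without first
element is joined to all earlier ones.

For the remaining pairs \<open>a < b\<close> consider the set \<open>Inf a b\<close> of infinite classes strictly between them.
If it is infinite, then it contains classes whose points are still free in any approximation of \<open>z\<close>,
so generically one of these points lies next to \<open>f (\<phi> a)\<close> or to the preimage of \<open>\<phi> b\<close>, and that
class serves as a bridge. If it is finite, then one of its members splits the problem into two with
fewer infinite classes. If it is empty, scatteredness excludes the case by \<open>rationals_embed\<close>.\<close>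
lemma scattered_labelling_exists:
  fixes L :: "'l::linorder set"
  assumes "countable L" and L: "lo \<in> L" "hi \<in> L" "lo < hi" "L \<subseteq> {lo..hi}"
    and far: "\<not> near L lo hi"
    and scattered: "\<not> (\<exists>e :: rat \<Rightarrow> 'l. strict_mono e \<and> range e \<subseteq> L)"
    and xy: "(x, y) \<in> generic_pairs"
  shows "\<exists>\<phi>. chain_labelling f L lo hi \<phi> \<and> \<phi> lo = x \<and> \<phi> hi = y"
proof -
  define rep where "rep a = (if near L a lo then lo else if near L a hi then hi else SOME b. b \<in> L \<and> near L a b)" for a
  have rep: "rep a \<in> L \<and> near L a (rep a)" if "a \<in> L" for a
    using L that someI[of "\<lambda>b. b \<in> L \<and> near L a b" a] by (auto simp: rep_def)
  have rep_eq: "rep a = rep b" if "near L a b" for a b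
  proof -
    have "near L a c \<longleftrightarrow> near L b c" for c using that near_trans near_sym by metis
    then show ?thesis by (simp add: rep_def)
  qed
  have rep_rep: "rep (rep a) = rep a" if "a \<in> L" for a using rep[OF that] rep_eq by metis
  have rep_near: "near L a b" if "rep a = rep b" "a \<in> L" "b \<in> L" for a b
    using rep[OF that(2)] rep[OF that(3)] that(1) near_trans near_sym by metis
  have rep_ends: "rep lo = lo" "rep hi = hi"
    using far near_sym[of L lo hi] by (auto simp: rep_def)
  obtain off :: "'l \<Rightarrow> int" where off0: "\<And>a. rep a = a \<Longrightarrow> off a = 0"
    and off: "\<And>a b. succ_in L a b \<Longrightarrow> off b = off a + 1"
    using class_offsets[of L rep] rep rep_eq by blast
  define A where "A z = z(lo := x, hi := y)" for z :: "'l \<Rightarrow> 'a"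
  define \<phi> where "\<phi> z a = iter (off a) (A z (rep a))" for z a
  have A_other: "A z c = z c" if "c \<in> L - {lo, hi}" for z c using that by (simp add: A_def)
  have contA [continuous_intros]: "continuous_on UNIV (\<lambda>z. A z c)" for c
    unfolding A_def by (rule continuous_pinned)
  have cont\<phi> [continuous_intros]: "continuous_on UNIV (\<lambda>z. \<phi> z a)" for a
    unfolding \<phi>_def by (intro continuous_intros)
  define Inf where "Inf a b = {c \<in> L. rep c = c \<and> a < c \<and> c < b \<and> \<not> near L a c \<and> \<not> near L c b
    \<and> (no_last L c \<or> no_first L c)}" for a b
  obtain \<G> where \<G>: "countable \<G>" "\<And>G. G \<in> \<G> \<Longrightarrow> open G \<and> closure G = UNIV"
    "{z. bitransitive z} = \<Inter>\<G>" using bitransitive_generic by blast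
  \<comment> \<open>The three kinds of generic conditions: bitransitive points, disjoint orbits for distinct classes, and bridges across infinitely many infinite classes.\<close>
  define B where "B = (\<lambda>(c, G). {z :: 'l \<Rightarrow> 'a. z c \<in> G})"
  define D where "D = (\<lambda>(c, c', k). {z. z c \<noteq> iter k (A z c')})"
  define E where "E = (\<lambda>(a, b, n). {z. \<exists>c\<in>Inf a b.
      (no_last L c \<and> dist (f (\<phi> z a)) (\<phi> z c) < 1 / real (Suc n)) \<or>
      (no_first L c \<and> dist (f (\<phi> z c)) (\<phi> z b) < 1 / real (Suc n))})"
  define BI where "BI = (L - {lo, hi}) \<times> \<G>"
  define DI where "DI = {(c, c', k :: int). c \<in> L - {lo, hi} \<and> c' \<in> L \<and> c \<noteq> c'}"
  define EI where "EI = {(a, b, n :: nat). a \<in> L \<and> b \<in> L \<and> infinite (Inf a b)}"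
  have "\<exists>z. \<forall>G\<in>B ` BI \<union> D ` DI \<union> E ` EI. z \<in> G"
  proof (rule generic_function_exists[OF compact_UNIV])
    have "countable BI" "countable (L \<times> L \<times> (UNIV :: int set))" "countable (L \<times> L \<times> (UNIV :: nat set))"
      using assms(1) \<G>(1) by (simp_all add: BI_def)
    moreover have "DI \<subseteq> L \<times> L \<times> UNIV" "EI \<subseteq> L \<times> L \<times> UNIV" by (auto simp: DI_def EI_def)
    ultimately have "countable BI" "countable DI" "countable EI" using countable_subset by blast+
    then show "countable (B ` BI \<union> D ` DI \<union> E ` EI)" by simp
  next
    have "open (B p)" if "p \<in> BI" for p
    proof -
      obtain c G where p: "p = (c, G)" by (cases p)
      have "open G" using \<open>p \<in> BI\<close> \<G>(2) by (simp add: p BI_def)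
      have "B p = (\<lambda>z. z c) -` G" by (auto simp: p B_def)
      then show ?thesis using \<open>open G\<close> by (simp add: open_vimage)
    qed
    moreover have "open (D p)" for p
      unfolding D_def by (cases p) (auto intro!: open_Collect_neq continuous_intros)
    moreover have "open (E p)" for p
    proof -
      obtain a b n where p: "p = (a, b, n)" by (cases p)
      show ?thesis
        unfolding E_def p prod.case Collect_bex_eq
        by (intro open_UN ballI open_Collect_disj open_Collect_conj open_Collect_const
            open_Collect_less continuous_intros)
    qed
    ultimately show "open G" if "G \<in> B ` BI \<union> D ` DI \<union> E ` EI" for G using that by auto
  next
    fix G and z :: "'l \<Rightarrow> 'a" and I :: "'l set" and e :: real
    assume G: "G \<in> B ` BI \<union> D ` DI \<union> E ` EI" and I: "finite I" and e: "0 < e"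
    from G consider (B) c H where "(c, H) \<in> BI" "G = B (c, H)"
      | (D) c c' k where "(c, c', k) \<in> DI" "G = D (c, c', k)"
      | (E) a b n where "(a, b, n) \<in> EI" "G = E (a, b, n)"
      by (elim UnE imageE) (metis prod_cases3 surj_pair)+
    then show "\<exists>w\<in>G. \<forall>i\<in>I. dist (w i) (z i) < e"
    proof cases
      case B
      then have "ball (z c) e \<inter> H \<noteq> {}"
        using \<G>(2)[of H] open_Int_closure_eq_empty[of "ball (z c) e" H] e by (auto simp: BI_def)
      then obtain p where "p \<in> ball (z c) e" "p \<in> H" by blast
      then show ?thesis
        using e B by (intro bexI[of _ "z(c := p)"]) (auto simp: B_def dist_commute)
    next
      case D
      obtain p where p: "p \<in> ball (z c) e - {iter k (A z c')}"
        using open_avoid_finite[of "ball (z c) e" "{iter k (A z c')}"] e by auto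
      let ?w = "z(c := p)"
      have "A ?w c' = A z c'" using D(1) by (auto simp: DI_def A_def)
      then have "?w \<in> G" using p D(2) by (simp add: D_def)
      moreover have "\<forall>i\<in>I. dist (?w i) (z i) < e" using p e by (simp add: dist_commute)
      ultimately show ?thesis by blast
    next
      case E
      then have ab: "a \<in> L" "b \<in> L" and "infinite (Inf a b - I)" using I by (auto simp: EI_def)
      then obtain c where "c \<in> Inf a b - I" by (metis ex_in_conv finite.emptyI)
      then have c: "c \<in> Inf a b" "c \<in> L" "c \<notin> I" "a < c" "c < b" "rep c = c"
        "\<not> near L a c" "\<not> near L c b" "no_last L c \<or> no_first L c" by (auto simp: Inf_def)
      have "lo \<le> a" "b \<le> hi" using L(4) ab by auto
      then have c': "c \<in> L - {lo, hi}" using c(2,4,5) by auto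
      have "rep a \<noteq> c" "rep b \<noteq> c"
        using c rep_near[of a c] rep_near[of c b] ab by auto
      \<comment> \<open>The free class \<open>c\<close> receives the exact continuation of \<open>\<phi> z a\<close>, or the exact preimage of \<open>\<phi> z b\<close>.\<close>
      define w where "w = z(c := if no_last L c then f (\<phi> z a) else iter (- 1) (\<phi> z b))"
      have "A w d = A z d" if "d \<noteq> c" for d using that by (auto simp: A_def w_def)
      then have ab': "\<phi> w a = \<phi> z a" "\<phi> w b = \<phi> z b"
        using \<open>rep a \<noteq> c\<close> \<open>rep b \<noteq> c\<close> by (auto simp: \<phi>_def)
      have "\<phi> w c = w c" using c c' by (simp add: \<phi>_def off0 A_other)
      then have cc: "\<phi> w c = (if no_last L c then f (\<phi> z a) else iter (- 1) (\<phi> z b))"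
        by (simp add: w_def)
      have "f (iter (- 1) (\<phi> z b)) = \<phi> z b"
        using iter_Suc[of "- 1" "\<phi> z b"] by simp
      then have "w \<in> G"
        unfolding E(2) E_def prod.case using c(9) by (intro CollectI bexI[OF _ c(1)]) (auto simp: ab' cc)
      moreover have "\<forall>i\<in>I. dist (w i) (z i) < e" using c(3) e by (auto simp: w_def)
      ultimately show ?thesis by blast
    qed
  qed
  then obtain z where z: "\<forall>G\<in>B ` BI \<union> D ` DI \<union> E ` EI. z \<in> G" ..
  have xy': "bitransitive x" "bitransitive y" "\<And>k. y \<noteq> iter k x"
    using xy by (auto simp: generic_pairs_def)
  have bitrans: "bitransitive (A z c)" if "c \<in> L" for c
  proof (cases "c \<in> {lo, hi}")
    case True
    then show ?thesis using xy' by (auto simp: A_def)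
  next
    case False
    have "z c \<in> G" if "G \<in> \<G>" for G
    proof -
      have "z \<in> B (c, G)" by (intro z[THEN bspec] UnI1 imageI) (use False that \<open>c \<in> L\<close> in \<open>simp add: BI_def\<close>)
      then show ?thesis by (simp add: B_def)
    qed
    then have "z c \<in> {z. bitransitive z}" unfolding \<G>(3) by blast
    then show ?thesis using False that by (simp add: A_other)
  qed
  have avoid: "A z c \<noteq> iter k (A z c')" if "c \<in> L - {lo, hi}" "c' \<in> L" "c \<noteq> c'" for c c' k
  proof -
    have "z \<in> D (c, c', k)" by (intro z[THEN bspec] UnI1 UnI2[of _ "D ` DI"] imageI) (use that in \<open>simp add: DI_def\<close>)
    then show ?thesis using that by (simp add: D_def A_other)
  qed
  have distinct_orbits: "iter i (A z c) \<noteq> iter j (A z c')" if "c \<in> L" "c' \<in> L" "c \<noteq> c'" for c c' i j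
  proof -
    consider "c \<in> L - {lo, hi}" | "c' \<in> L - {lo, hi}" | "c = lo" "c' = hi" | "c = hi" "c' = lo"
      using \<open>c \<in> L\<close> \<open>c' \<in> L\<close> \<open>c \<noteq> c'\<close> by blast
    then show ?thesis
    proof cases
      case 1
      then show ?thesis using avoid[of c c' "j - i"] that by (simp add: iter_eq_iff)
    next
      case 2
      then have "A z c' \<noteq> iter (i - j) (A z c)" using avoid that by metis
      then show ?thesis using iter_eq_iff[of j "A z c'" i "A z c"] by metis
    next
      case 3
      then have "A z c = x" "A z c' = y" using L(3) by (auto simp: A_def)
      then show ?thesis using xy'(3)[of "i - j"] iter_eq_iff[of j y i x] by metis
    next
      case 4
      then have "A z c = y" "A z c' = x" using L(3) by (auto simp: A_def)
      then show ?thesis using xy'(3)[of "j - i"] iter_eq_iff[of i y j x] by metis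
    qed
  qed
  have inj: "\<phi> z a \<noteq> \<phi> z b" if "a \<in> L" "b \<in> L" "a \<noteq> b" for a b
  proof (cases "rep a = rep b")
    case True
    then have "near L a b" using rep_near that by blast
    then have near: "near L a b" "near L b a" by (simp_all add: near_sym)
    have "off a \<noteq> off b"
    proof (cases "a < b")
      case True
      then show ?thesis using off_strict_mono[of L off a b, OF off] near(1) True that by force
    next
      case False
      then have "b < a" using that by simp
      then show ?thesis using off_strict_mono[of L off b a, OF off] near(2) that by force
    qed
    moreover have "bitransitive (A z (rep a))" using bitrans rep that by blast
    ultimately show ?thesis
      using bitransitive_aperiodic[of "A z (rep a)" "off b - off a"] True
      by (auto simp: \<phi>_def iter_eq_iff dest: sym)
  next
    case False
    then show ?thesis unfolding \<phi>_def using distinct_orbits rep that by metis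
  qed
  have paths: "(label_step f L (\<phi> z) \<epsilon>)\<^sup>+\<^sup>+ a b" if "0 < \<epsilon>" "a \<in> L" "b \<in> L" "a < b" for \<epsilon> a b
  proof -
    let ?R = "label_step f L (\<phi> z) \<epsilon>"
    have within: "?R\<^sup>+\<^sup>+ a b" if "a \<in> L" "b \<in> L" "a < b" "near L a b" for a b
      using near_succ_path[OF that]
    proof (rule tranclp_refine)
      fix c d assume cd: "succ_in L c d"
      then have "\<phi> z d = f (\<phi> z c)"
        using off[OF cd] rep_eq[OF succ_in_near[OF cd]] by (simp add: \<phi>_def iter_Suc)
      then have "?R c d" using cd \<open>0 < \<epsilon>\<close> by (simp add: label_step_def succ_in_def)
      then show "?R\<^sup>+\<^sup>+ c d" ..
    qed
    have upwards: "?R\<^sup>+\<^sup>+ a b" if "a \<in> L" "b \<in> L" "a < b" "\<not> near L a b" "no_last L a" for a b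
    proof -
      have unbounded: "\<exists>u\<in>L. near L a u \<and> a \<le> u \<and> off u = k" if "off a \<le> k" for k
        using that
      proof (induction k rule: int_ge_induct)
        case base
        then show ?case using \<open>a \<in> L\<close> by (intro bexI[of _ a]) auto
      next
        case (step k)
        then obtain u where u: "u \<in> L" "near L a u" "a \<le> u" "off u = k" by blast
        then obtain v where v: "v \<in> L" "near L a v" "u < v" using \<open>no_last L a\<close> unfolding no_last_def by blast
        have "near L u v" using u(2) v(2) near_sym near_trans by metis
        then obtain s where s: "succ_in L u s" "near L u s" using succ_exists u(1) v(1,3) by blast
        then have "s \<in> L" "near L a s" "a \<le> s" "off s = k + 1"
          using u off[OF s(1)] near_trans by (auto simp: succ_in_def)
        then show ?case by blast
      qed
      let ?V = "f -` ball (\<phi> z b) \<epsilon>"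
      have "open ?V" by (intro open_vimage continuous_f) simp
      moreover have "inv f (\<phi> z b) \<in> ?V" using \<open>0 < \<epsilon>\<close> by simp
      moreover have "bitransitive (A z (rep a))" using bitrans rep \<open>a \<in> L\<close> by blast
      ultimately obtain k where k: "off a \<le> k" "iter k (A z (rep a)) \<in> ?V"
        unfolding bitransitive_def by blast
      obtain u where u: "u \<in> L" "near L a u" "a \<le> u" "off u = k" using unbounded k(1) by blast
      then have "\<phi> z u = iter k (A z (rep a))" using rep_eq[OF u(2)] by (simp add: \<phi>_def)
      moreover have "u < b"
      proof (rule ccontr)
        assume "\<not> u < b"
        then show False using near_subinterval[OF u(2), of a b] that by (auto simp: not_less intro: less_imp_le)
      qed
      ultimately have "?R u b" using k(2) u(1) that by (simp add: label_step_def dist_commute)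
      moreover have "a = u \<or> ?R\<^sup>+\<^sup>+ a u" using within u that(1) by (metis order_le_less)
      ultimately show ?thesis by (metis tranclp.r_into_trancl tranclp.trancl_into_trancl)
    qed
    have downwards: "?R\<^sup>+\<^sup>+ a b" if "a \<in> L" "b \<in> L" "a < b" "\<not> near L a b" "no_first L b" for a b
    proof -
      have unbounded: "\<exists>u\<in>L. near L b u \<and> u \<le> b \<and> off u = k" if "k \<le> off b" for k
        using that
      proof (induction k rule: int_le_induct)
        case base
        then show ?case using \<open>b \<in> L\<close> by (intro bexI[of _ b]) auto
      next
        case (step k)
        then obtain u where u: "u \<in> L" "near L b u" "u \<le> b" "off u = k" by blast
        then obtain v where v: "v \<in> L" "near L b v" "v < u" using \<open>no_first L b\<close> unfolding no_first_def by blast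
        have "near L v u" using u(2) v(2) near_sym near_trans by metis
        then obtain s where s: "succ_in L s u" "near L s u" using pred_exists u(1) v(1,3) by blast
        have "near L b s" using near_trans[OF u(2)] s(2) near_sym by metis
        moreover have "s \<in> L" "s \<le> b" "off s = k - 1"
          using u s(1) off[OF s(1)] by (auto simp: succ_in_def)
        ultimately show ?case by blast
      qed
      let ?V = "ball (f (\<phi> z a)) \<epsilon>"
      have "open ?V" "?V \<noteq> {}" using \<open>0 < \<epsilon>\<close> by auto
      moreover have "bitransitive (A z (rep b))" using bitrans rep \<open>b \<in> L\<close> by blast
      ultimately obtain k where k: "k \<le> off b" "iter k (A z (rep b)) \<in> ?V"
        unfolding bitransitive_def by blast
      obtain u where u: "u \<in> L" "near L b u" "u \<le> b" "off u = k" using unbounded k(1) by blast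
      then have "\<phi> z u = iter k (A z (rep b))" using rep_eq[OF u(2)] by (simp add: \<phi>_def)
      moreover have "a < u"
      proof (rule ccontr)
        assume "\<not> a < u"
        then show False using near_subinterval[of L u b a b] u(2) that by (auto simp: near_sym not_less intro: less_imp_le)
      qed
      ultimately have "?R a u" using k(2) u(1) that by (simp add: label_step_def)
      moreover have "u = b \<or> ?R\<^sup>+\<^sup>+ u b" using within u that(2) near_sym by (metis order_le_less)
      ultimately show ?thesis by (metis tranclp.r_into_trancl tranclp_into_tranclp2)
    qed
    show ?thesis
      using \<open>a \<in> L\<close> \<open>b \<in> L\<close> \<open>a < b\<close>
    proof (induction "card (Inf a b)" arbitrary: a b rule: less_induct)
      case less
      consider "near L a b" | "\<not> near L a b" "no_last L a" | "\<not> near L a b" "no_first L b"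
        | (infinite) "infinite (Inf a b)"
        | (finite) "\<not> near L a b" "\<not> no_last L a" "\<not> no_first L b" "finite (Inf a b)" by blast
      then show ?case
      proof cases
        case infinite
        obtain n where n: "1 / real (Suc n) < \<epsilon>" using nat_approx_posE \<open>0 < \<epsilon>\<close> by blast
        have "z \<in> E (a, b, n)"
          by (intro z[THEN bspec] UnI2 imageI) (use infinite less.prems in \<open>simp add: EI_def\<close>)
        then obtain c where "c \<in> Inf a b" and
          link: "(no_last L c \<and> dist (f (\<phi> z a)) (\<phi> z c) < 1 / real (Suc n)) \<or>
            (no_first L c \<and> dist (f (\<phi> z c)) (\<phi> z b) < 1 / real (Suc n))"
          unfolding E_def prod.case by blast
        then have c: "c \<in> L" "a < c" "c < b" "\<not> near L a c" "\<not> near L c b" by (auto simp: Inf_def)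
        from link show ?thesis
        proof (elim disjE conjE)
          assume "no_last L c" "dist (f (\<phi> z a)) (\<phi> z c) < 1 / real (Suc n)"
          then have "?R a c" "?R\<^sup>+\<^sup>+ c b"
            using n c less.prems upwards by (auto simp: label_step_def)
          then show ?thesis by (rule tranclp_into_tranclp2)
        next
          assume "no_first L c" "dist (f (\<phi> z c)) (\<phi> z b) < 1 / real (Suc n)"
          then have "?R\<^sup>+\<^sup>+ a c" "?R c b"
            using n c less.prems downwards by (auto simp: label_step_def)
          then show ?thesis by (rule tranclp.trancl_into_trancl)
        qed
      next
        case finite
        have "Inf a b \<noteq> {}"
        proof
          assume empty: "Inf a b = {}"
          have "\<not> no_last L c \<and> \<not> no_first L c"
            if c: "c \<in> L" "a < c" "c < b" "\<not> near L a c" "\<not> near L c b" for c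
          proof -
            have r: "rep c \<in> L" "near L c (rep c)" "rep (rep c) = rep c" using rep[OF c(1)] rep_rep[OF c(1)] by auto
            have nr: "\<not> near L a (rep c)" "\<not> near L (rep c) b"
              using r(2) c(4,5) near_trans near_sym by metis+
            have "a < rep c"
            proof (rule ccontr)
              assume "\<not> a < rep c"
              then show False using near_subinterval[of L "rep c" c a c] r(2) c by (auto simp: near_sym not_less intro: less_imp_le)
            qed
            moreover have "rep c < b"
            proof (rule ccontr)
              assume "\<not> rep c < b"
              then show False using near_subinterval[OF r(2), of c b] c by (auto simp: not_less intro: less_imp_le)
            qed
            ultimately have "\<not> no_last L (rep c) \<and> \<not> no_first L (rep c)"
              using empty r nr by (auto simp: Inf_def)
            then show ?thesis using no_last_cong[OF r(2)] no_first_cong[OF r(2)] by simp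
          qed
          then show False using rationals_embed[OF less.prems finite(1-3)] scattered by blast
        qed
        then obtain c where cI: "c \<in> Inf a b" by blast
        then have c: "c \<in> L" "a < c" "c < b" by (auto simp: Inf_def)
        have not: "\<not> near L a d" if "\<not> near L a c" "c < d" for d
          using that c(2) near_subinterval[of L a d a c] by (auto intro: less_imp_le)
        have not': "\<not> near L d b" if "\<not> near L c b" "d < c" for d
          using that c(3) near_subinterval[of L d b c b] by (auto intro: less_imp_le)
        have "Inf a c \<subset> Inf a b" "Inf c b \<subset> Inf a b"
          using cI not not' c by (auto simp: Inf_def)
        then have "card (Inf a c) < card (Inf a b)" "card (Inf c b) < card (Inf a b)"
          using finite(4) by (auto intro: psubset_card_mono)
        then have "?R\<^sup>+\<^sup>+ a c" "?R\<^sup>+\<^sup>+ c b" using less.hyps less.prems c by auto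
        then show ?thesis by (rule tranclp_trans)
      qed (use within upwards downwards less.prems in auto)
    qed
  qed
  have "chain_labelling f L lo hi (\<phi> z)"
    unfolding chain_labelling_def using L inj paths by simp
  moreover have "\<phi> z lo = x" "\<phi> z hi = y"
    using rep_ends L(3) by (auto simp: \<phi>_def off0 A_def)
  ultimately show ?thesis by blast
qed

end

section \<open>Countable orders as sets of reals\<close>

text \<open>Send \<open>i\<close> to the sum of \<open>2^-(n+1)\<close> over all \<open>n\<close> with \<open>(n, i) \<in> r\<close>: a larger element has all the
terms of a smaller one and its own term besides.\<close>
lemma linear_order_embeds_real:
  fixes r :: "nat rel"
  assumes "Linear_order r"
  shows "\<exists>e :: nat \<Rightarrow> real. (\<forall>i\<in>Field r. 0 < e i \<and> e i < 2) \<and>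
    (\<forall>i\<in>Field r. \<forall>j\<in>Field r. (i, j) \<in> r \<longleftrightarrow> e i \<le> e j)"
proof -
  have refl: "(i, i) \<in> r" if "i \<in> Field r" for i
    using assms that by (auto simp: order_on_defs refl_on_def)
  have trans: "(i, k) \<in> r" if "(i, j) \<in> r" "(j, k) \<in> r" for i j k
    using assms that by (auto simp: order_on_defs dest: transD)
  have antisym: "i = j" if "(i, j) \<in> r" "(j, i) \<in> r" for i j
    using assms that by (auto simp: order_on_defs dest: antisymD)
  have total: "(i, j) \<in> r \<or> (j, i) \<in> r" if "i \<in> Field r" "j \<in> Field r" for i j
    using assms that refl by (cases "i = j") (auto simp: order_on_defs total_on_def)
  define w where "w i n = (if (n, i) \<in> r then (1 / 2 :: real) ^ Suc n else 0)" for i n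
  define e where "e i = suminf (w i)" for i
  have half: "summable (\<lambda>n. (1 / 2 :: real) ^ Suc n)" "(\<Sum>n. (1 / 2 :: real) ^ Suc n) = 1"
    using power_half_series by (auto simp: sums_iff)
  have sm: "summable (w i)" for i
    using half(1) by (rule summable_comparison_test'[where N = 0]) (simp add: w_def)
  have "0 < e i \<and> e i < 2" if "i \<in> Field r" for i
  proof -
    have "0 < e i"
      unfolding e_def using sm by (rule suminf_pos2[where i = i]) (simp_all add: w_def refl that)
    moreover have "suminf (w i) \<le> (\<Sum>n. (1 / 2 :: real) ^ Suc n)"
      using sm half(1) by (intro suminf_le) (simp add: w_def)
    then have "e i \<le> 1" unfolding e_def half(2) .
    ultimately show ?thesis by simp
  qed
  moreover have less: "e i < e j" if "(i, j) \<in> r" "i \<noteq> j" for i j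
  proof -
    have "j \<in> Field r" using that by (auto simp: Field_def)
    have "0 < (\<Sum>n. w j n - w i n)"
    proof (rule suminf_pos2[where i = j])
      show "summable (\<lambda>n. w j n - w i n)" using sm by (intro summable_diff)
      show "0 \<le> w j n - w i n" for n using trans that by (auto simp: w_def)
      show "0 < w j j - w i j" using antisym that refl[OF \<open>j \<in> Field r\<close>] by (auto simp: w_def)
    qed
    then show ?thesis using suminf_diff[OF sm sm, of j i] by (simp add: e_def)
  qed
  have "(i, j) \<in> r \<longleftrightarrow> e i \<le> e j" if "i \<in> Field r" "j \<in> Field r" for i j
    using less[of i j] less[of j i] total[OF that] refl that by (cases "i = j") auto
  ultimately show ?thesis by blast
qed

section \<open>Order-types in the spectrum\<close>

context transitive_system
begin

text \<open>A finite order consists of a single class, so it is laid out along one aperiodic orbit.\<close>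
lemma finite_labelling_exists:
  fixes L :: "'l::linorder set"
  assumes "finite L" and L: "lo \<in> L" "hi \<in> L" "lo < hi" "L \<subseteq> {lo..hi}" and "bitransitive x"
  shows "\<exists>\<phi>. chain_labelling f L lo hi \<phi>"
proof -
  have near: "near L a b" for a b using assms(1) by (simp add: near_def)
  obtain off :: "'l \<Rightarrow> int" where off: "\<And>a b. succ_in L a b \<Longrightarrow> off b = off a + 1"
    using class_offsets[of L "\<lambda>_. lo"] near by blast
  define \<phi> where "\<phi> a = iter (off a) x" for a
  have "\<phi> a \<noteq> \<phi> b" if "a \<in> L" "b \<in> L" "a \<noteq> b" for a b
  proof -
    have "off a \<noteq> off b"
      using off_strict_mono[of L off a b, OF off] off_strict_mono[of L off b a, OF off] that near
      by (metis less_irrefl linorder_neqE)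
    then show ?thesis
      using bitransitive_aperiodic[OF assms(6), of "off b - off a"] by (auto simp: \<phi>_def iter_eq_iff)
  qed
  moreover have "(label_step f L \<phi> \<epsilon>)\<^sup>+\<^sup>+ a b" if "0 < \<epsilon>" "a \<in> L" "b \<in> L" "a < b" for \<epsilon> a b
    using near_succ_path[OF that(2-4) near]
  proof (rule tranclp_refine)
    fix c d assume "succ_in L c d"
    then have "label_step f L \<phi> \<epsilon> c d"
      using off[of c d] \<open>0 < \<epsilon>\<close> by (simp add: label_step_def succ_in_def \<phi>_def iter_Suc)
    then show "(label_step f L \<phi> \<epsilon>)\<^sup>+\<^sup>+ c d" ..
  qed
  ultimately have "chain_labelling f L lo hi \<phi>" using L by (simp add: chain_labelling_def)
  then show ?thesis by blast
qed

text \<open>A countable order is moved into the open interval from 0 to 2, and 0 and 2 are added as labels of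
the endpoints. Adding two ends creates no copy of the rationals, because the image of a rational is
never extreme.\<close>
lemma countable_order_in_spectrum:
  fixes r :: "nat rel"
  assumes "Linear_order r"
  shows "\<exists>L :: real set. countable L \<and> 0 \<in> L \<and> 2 \<in> L \<and> L \<subseteq> {0..2} \<and> (finite L \<longleftrightarrow> finite (Field r)) \<and>
    (scattered r \<longrightarrow> \<not> (\<exists>e :: rat \<Rightarrow> real. strict_mono e \<and> range e \<subseteq> L)) \<and>
    (\<forall>\<phi>. chain_labelling f L 0 2 \<phi> \<longrightarrow> order_type r \<in> spectrum f (\<phi> 0) (\<phi> 2))"
proof -
  obtain e :: "nat \<Rightarrow> real" where e: "\<And>i. i \<in> Field r \<Longrightarrow> 0 < e i \<and> e i < 2"
    "\<And>i j. i \<in> Field r \<Longrightarrow> j \<in> Field r \<Longrightarrow> (i, j) \<in> r \<longleftrightarrow> e i \<le> e j"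
    using linear_order_embeds_real[OF assms] by blast
  have refl: "(i, i) \<in> r" if "i \<in> Field r" for i using e(2)[OF that that] by simp
  have inj: "inj_on e (Field r)"
  proof (rule inj_onI)
    fix i j assume "i \<in> Field r" "j \<in> Field r" "e i = e j"
    then have "(i, j) \<in> r" "(j, i) \<in> r" using e(2) by auto
    then show "i = j" using assms by (auto simp: order_on_defs dest: antisymD)
  qed
  define L where "L = {0, 2} \<union> e ` Field r"
  have interior: "L - {0, 2} = e ` Field r" using e(1) by (force simp: L_def)
  have "L \<subseteq> {0..2}" using e(1) by (force simp: L_def)
  have "\<not> scattered r" if g: "strict_mono g" "range g \<subseteq> L" for g :: "rat \<Rightarrow> real"
  proof -
    have g_in: "g p \<in> e ` Field r" for p
    proof -
      have "g (p - 1) < g p" "g p < g (p + 1)" using g(1) by (simp_all add: strict_mono_def)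
      moreover have "g (p - 1) \<in> {0..2}" "g (p + 1) \<in> {0..2}" using g(2) \<open>L \<subseteq> {0..2}\<close> by blast+
      ultimately have "g p \<notin> {0, 2}" by auto
      then show ?thesis using g(2) interior by blast
    qed
    define h where "h p = inv_into (Field r) e (g p)" for p
    have h: "h p \<in> Field r" "e (h p) = g p" for p
      using g_in inv_into_into f_inv_into_f unfolding h_def by metis+
    have "h p \<in> Field (Restr r (range h))" for p
      using refl[OF h(1)] by (intro FieldI1[of _ "h p"]) simp
    then have Field: "Field (Restr r (range h)) = range h" by (auto simp: Field_def)
    have "inj h" using h(2) g(1) by (metis injI strict_mono_eq)
    moreover have "Field rat_order = UNIV" by (auto simp: rat_order_def Field_def)
    moreover have "(p, q) \<in> rat_order \<longleftrightarrow> (h p, h q) \<in> Restr r (range h)" for p q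
      using h(1)[of p] h(1)[of q] strict_mono_less_eq[OF g(1), of p q] e(2)[of "h p" "h q"]
      by (simp add: rat_order_def h(2))
    ultimately have "iso rat_order (Restr r (range h)) h"
      unfolding iso_iff2 Field by (simp add: bij_betw_def)
    then show ?thesis unfolding scattered_def using h(1) by blast
  qed
  moreover have "order_type r \<in> spectrum f (\<phi> 0) (\<phi> 2)" if "chain_labelling f L 0 2 \<phi>" for \<phi>
    using e(2) inj interior by (intro order_type_in_spectrum[OF _ that, of e]) (auto simp: L_def bij_betw_def)
  moreover have "finite L \<longleftrightarrow> finite (Field r)" using inj by (simp add: L_def finite_image_iff)
  moreover have "countable L" "0 \<in> L" "2 \<in> L" by (simp_all add: L_def)
  ultimately show ?thesis using \<open>L \<subseteq> {0..2}\<close> by blast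
qed

theorem infinite_scattered_in_spectrum:
  fixes r :: "nat rel"
  assumes "(x, y) \<in> generic_pairs" "Linear_order r" "scattered r" "infinite (Field r)"
  shows "order_type r \<in> spectrum f x y"
proof -
  obtain L :: "real set" where L: "countable L" "0 \<in> L" "2 \<in> L" "L \<subseteq> {0..2}" "infinite L"
    "\<not> (\<exists>e :: rat \<Rightarrow> real. strict_mono e \<and> range e \<subseteq> L)"
    and spec: "\<forall>\<phi>. chain_labelling f L 0 2 \<phi> \<longrightarrow> order_type r \<in> spectrum f (\<phi> 0) (\<phi> 2)"
    using countable_order_in_spectrum[OF assms(2)] assms(3,4) by metis
  have "L \<inter> {0..2} = L" using L(4) by blast
  then have "\<not> near L 0 2" using L(5) by (simp add: near_le)
  then obtain \<phi> where "chain_labelling f L 0 2 \<phi>" "\<phi> 0 = x" "\<phi> 2 = y"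
    using scattered_labelling_exists[OF L(1-3) _ L(4) _ L(6) assms(1)] by auto
  then show ?thesis using spec by blast
qed

theorem scattered_in_total_spectrum:
  fixes r :: "nat rel"
  assumes "Linear_order r" "scattered r"
  shows "order_type r \<in> total_spectrum f"
proof (cases "finite (Field r)")
  case True
  obtain L :: "real set" where L: "0 \<in> L" "2 \<in> L" "L \<subseteq> {0..2}" "finite L"
    and spec: "\<forall>\<phi>. chain_labelling f L 0 2 \<phi> \<longrightarrow> order_type r \<in> spectrum f (\<phi> 0) (\<phi> 2)"
    using countable_order_in_spectrum[OF assms(1)] True by metis
  obtain x where "bitransitive x" using generic_pairs_nonempty by (auto simp: generic_pairs_def)
  then obtain \<phi> where "chain_labelling f L 0 2 \<phi>"
    using finite_labelling_exists[OF L(4,1,2) _ L(3)] by auto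
  then show ?thesis using spec by (auto simp: total_spectrum_def)
next
  case False
  then show ?thesis
    using generic_pairs_nonempty infinite_scattered_in_spectrum[OF _ assms] by (fastforce simp: total_spectrum_def)
qed

theorem eta_in_spectrum: "eta_type \<in> spectrum f x y"
proof -
  define e where "e q = ereal (of_rat q)" for q :: rat
  define L where "L = {-\<infinity>, \<infinity>} \<union> range e"
  have interior: "L - {-\<infinity>, \<infinity>} = range e" by (auto simp: L_def e_def)
  have between: "\<exists>c\<in>L. a < c \<and> c < b" if "a < b" for a b
  proof -
    obtain s where s: "a < ereal s" "ereal s < b" using ereal_dense2[OF \<open>a < b\<close>] by blast
    obtain t where t: "ereal s < ereal t" "ereal t < b" using ereal_dense2[of "ereal s" b] s(2) by blast
    obtain q where q: "s < of_rat q" "of_rat q < t" using of_rat_dense[of s t] t(1) by auto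
    have "a < e q" using less_trans[OF s(1), of "e q"] q(1) by (simp add: e_def)
    moreover have "e q < b" using less_trans[OF _ t(2), of "e q"] q(2) by (simp add: e_def)
    ultimately have "a < e q" "e q < b" by auto
    then show ?thesis by (auto simp: L_def)
  qed
  have dense: "infinite (L \<inter> {a<..<b})" if "a < b" for a b
  proof
    assume fin: "finite (L \<inter> {a<..<b})"
    then have "Min (L \<inter> {a<..<b}) \<in> L \<inter> {a<..<b}" using between[OF that] by (intro Min_in) auto
    then obtain c where c: "c \<in> L" "a < c" "c < Min (L \<inter> {a<..<b})" "Min (L \<inter> {a<..<b}) < b"
      using between[of a "Min (L \<inter> {a<..<b})"] by auto
    then have "c \<in> L \<inter> {a<..<b}" by auto
    then have "Min (L \<inter> {a<..<b}) \<le> c" by (rule Min_le[OF fin])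
    then show False using c(3) by simp
  qed
  have "\<exists>\<phi>. chain_labelling f L (-\<infinity>) \<infinity> \<phi> \<and> \<phi> (-\<infinity>) = x \<and> \<phi> \<infinity> = y"
    by (rule dense_labelling_exists) (use dense in \<open>auto simp: L_def\<close>)
  then obtain \<phi> where \<phi>: "chain_labelling f L (-\<infinity>) \<infinity> \<phi>" "\<phi> (-\<infinity>) = x" "\<phi> \<infinity> = y" by blast
  have Field: "Field rat_order = UNIV" by (auto simp: rat_order_def Field_def)
  have "order_type rat_order \<in> spectrum f (\<phi> (-\<infinity>)) (\<phi> \<infinity>)"
  proof (rule order_type_in_spectrum[OF _ \<phi>(1), of e])
    show "countable L" by (simp add: L_def)
    show "bij_betw e (Field rat_order) (L - {-\<infinity>, \<infinity>})"
      unfolding interior Field bij_betw_def by (simp add: inj_def e_def)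
    show "(p, q) \<in> rat_order \<longleftrightarrow> e p \<le> e q" for p q by (simp add: rat_order_def e_def of_rat_less_eq)
  qed
  then show ?thesis using \<phi> by (simp add: eta_type_def)
qed

text \<open>If the limit order is finite, then all chains live in one finite set. Once \<open>\<epsilon>\<close> is smaller than all
positive distances from the images of its points to its points, every jump is exact, and the chain is
an orbit segment.\<close>
lemma finite_type_imp_forward_orbit:
  assumes "finite_type K \<in> spectrum f x y"
  shows "y \<in> forward_orbit f x"
proof -
  obtain m C where type: "finite_type K = order_type (limit_order x y m C)"
    and ocn: "order_compatible_nested f x y m C" using assms by (auto simp: spectrum_def)
  have "{(i :: nat, j). i \<le> j \<and> j < K} \<in> finite_type K"
    unfolding finite_type_def order_type_def using id_iso by blast
  then obtain h where "iso (limit_order x y m C) {(i :: nat, j). i \<le> j \<and> j < K} h"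
    unfolding type order_type_def by blast
  then have bij: "bij_betw h (Field (limit_order x y m C)) (Field {(i :: nat, j). i \<le> j \<and> j < K})"
    by (simp add: iso_iff2)
  have "Field {(i :: nat, j). i \<le> j \<and> j < K} \<subseteq> {..<K}" by (auto simp: Field_def)
  then have "finite (Field {(i :: nat, j). i \<le> j \<and> j < K})" by (rule finite_subset) simp
  then have "finite (Field (limit_order x y m C))" by (simp only: bij_betw_finite[OF bij])
  moreover have "Field (limit_order x y m C) = limit_carrier x y m C"
    by (auto simp: Field_def limit_order_def)
  ultimately have "finite (limit_carrier x y m C)" by simp
  then have finS: "finite (limit_carrier x y m C \<union> {x, y})" (is "finite ?S") by simp
  \<comment> \<open>The element 1 only keeps the set nonempty.\<close>
  define \<Delta> where "\<Delta> = insert 1 ((\<lambda>(u, v). dist (f u) v) ` {(u, v) \<in> ?S \<times> ?S. f u \<noteq> v})"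
  have "finite \<Delta>" unfolding \<Delta>_def using finS by (intro finite.insertI finite_imageI)
      (rule finite_subset[of _ "?S \<times> ?S"], auto)
  moreover have "0 < \<delta>" if "\<delta> \<in> \<Delta>" for \<delta> using that by (auto simp: \<Delta>_def)
  ultimately have "0 < Min \<Delta>" by (simp add: \<Delta>_def)
  obtain \<epsilon> :: "nat \<Rightarrow> real" where \<epsilon>: "\<epsilon> \<longlonglongrightarrow> 0" "\<And>n. chain f (\<epsilon> n) x y (m n) (C n)"
    using ocn unfolding order_compatible_nested_def by blast
  obtain n where n: "\<epsilon> n < Min \<Delta>"
    using order_tendstoD(2)[OF \<epsilon>(1) \<open>0 < Min \<Delta>\<close>] by (auto simp: eventually_sequentially)
  have chain: "1 \<le> m n" "C n 0 = x" "C n (m n) = y" "\<And>i. i < m n \<Longrightarrow> dist (f (C n i)) (C n (Suc i)) < \<epsilon> n"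
    using \<epsilon>(2)[of n] by (auto simp: chain_def)
  have inS: "C n i \<in> ?S" if "i \<le> m n" for i
  proof -
    have "C n i \<in> chain_support (m n) (C n)" using that by (simp add: chain_support_def)
    then show ?thesis unfolding limit_carrier_def by blast
  qed
  have exact: "f (C n i) = C n (Suc i)" if "i < m n" for i
  proof (rule ccontr)
    assume "f (C n i) \<noteq> C n (Suc i)"
    then have "dist (f (C n i)) (C n (Suc i)) \<in> \<Delta>"
      using inS[of i] inS[of "Suc i"] that unfolding \<Delta>_def by force
    then have "Min \<Delta> \<le> dist (f (C n i)) (C n (Suc i))" using \<open>finite \<Delta>\<close> by simp
    then show False using chain(4)[OF that] n by simp
  qed
  have "i \<le> m n \<Longrightarrow> C n i = (f ^^ i) x" for i
    by (induction i) (use exact chain(2) in \<open>auto simp: Suc_le_eq dest: sym\<close>)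
  then have "y = (f ^^ m n) x" using chain(3) by auto
  then show ?thesis using chain(1) by (auto simp: forward_orbit_def)
qed

text \<open>The orbit segment from \<open>x\<close> to its first visit to \<open>y\<close> at a positive time is acyclic, and the constant
sequence of this chain is nested. The visit has to be the first one also when \<open>x = y\<close> is periodic.\<close>
lemma forward_orbit_imp_finite_type:
  assumes "y \<in> forward_orbit f x"
  shows "\<exists>K. finite_type K \<in> spectrum f x y"
proof -
  define m where "m = (LEAST k. 1 \<le> k \<and> y = (f ^^ k) x)"
  have ex: "\<exists>k. 1 \<le> k \<and> y = (f ^^ k) x" using assms by (auto simp: forward_orbit_def)
  have m: "1 \<le> m" "y = (f ^^ m) x" using LeastI_ex[OF ex] by (auto simp: m_def)
  have minimal: "m \<le> k" if "1 \<le> k" "y = (f ^^ k) x" for k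
    using that by (auto simp: m_def intro: Least_le)
  have ne: "(f ^^ i) x \<noteq> (f ^^ j) x" if "i < j" "j \<le> m" "0 < i \<or> j < m" for i j
  proof
    assume eq: "(f ^^ i) x = (f ^^ j) x"
    have "y = (f ^^ ((m - j) + j)) x" using m(2) that(2) by simp
    also have "\<dots> = (f ^^ (m - j)) ((f ^^ i) x)" unfolding funpow_add eq by simp
    also have "\<dots> = (f ^^ (m - j + i)) x" by (simp add: funpow_add)
    finally have "m \<le> m - j + i" by (rule minimal[rotated]) (use that in auto)
    then show False using that by simp
  qed
  define \<phi> where "\<phi> i = (f ^^ i) x" for i
  have "chain_labelling f {0..m} 0 m \<phi>"
    unfolding chain_labelling_def
  proof (intro conjI allI ballI impI)
    fix i j assume "i \<in> {0..m} - {0, m}" "j \<in> {0..m}" "i \<noteq> j"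
    then show "\<phi> i \<noteq> \<phi> j" using ne[of i j] ne[of j i] by (cases "i < j") (auto simp: \<phi>_def)
  next
    fix \<epsilon> :: real and i j assume "0 < \<epsilon>" "i \<in> {0..m}" "j \<in> {0..m}" "i < j"
    have step: "label_step f {0..m} \<phi> \<epsilon> k (Suc k)" if "k < m" for k
      using that \<open>0 < \<epsilon>\<close> by (simp add: label_step_def \<phi>_def)
    have "i < k \<Longrightarrow> k \<le> m \<Longrightarrow> (label_step f {0..m} \<phi> \<epsilon>)\<^sup>+\<^sup>+ i k" for k
    proof (induction k)
      case (Suc k)
      then show ?case using step[of k] by (cases "i = k") (auto intro: tranclp.intros)
    qed simp
    then show "(label_step f {0..m} \<phi> \<epsilon>)\<^sup>+\<^sup>+ i j" using \<open>i < j\<close> \<open>j \<in> {0..m}\<close> by simp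
  qed (use m(1) in auto)
  moreover have Field: "Field {(i :: nat, j). i \<le> j \<and> j < m - 1} = {..<m - 1}" by (auto simp: Field_def)
  moreover have "bij_betw Suc {..<m - 1} ({0..m} - {0, m})"
  proof -
    have "Suc ` {..<m - 1} = {1..<m}"
      using m(1) image_Suc_atLeastLessThan[of 0 "m - 1"] by (simp add: atLeast0LessThan)
    also have "\<dots> = {0..m} - {0, m}" by auto
    finally show ?thesis by (simp add: bij_betw_def)
  qed
  ultimately have "finite_type (m - 1) \<in> spectrum f (\<phi> 0) (\<phi> m)"
    unfolding finite_type_def by (intro order_type_in_spectrum[where e = Suc]) auto
  then show ?thesis using m(2) by (auto simp: \<phi>_def)
qed

end

theorem theorem2p8:
  fixes f :: "'a::metric_space \<Rightarrow> 'a"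
  assumes "compact (UNIV :: 'a set)"
    and "\<forall>x :: 'a. \<not> open {x}"
    and "(UNIV :: 'a set) \<approx> (UNIV :: real set)"
    and "homeomorphism UNIV UNIV f (inv f)"
    and "transitive f"
  shows "(\<forall>r :: nat rel. Linear_order r \<and> scattered r \<longrightarrow> order_type r \<in> total_spectrum f)
    \<and> eta_type \<in> total_spectrum f
    \<and> (\<exists>M :: ('a \<times> 'a) set. comeagre M \<and>
         (\<forall>(x, y) \<in> M. \<forall>r :: nat rel.
            Linear_order r \<and> scattered r \<and> infinite (Field r) \<longrightarrow> order_type r \<in> spectrum f x y))
    \<and> (\<forall>x y. (\<exists>K. finite_type K \<in> spectrum f x y) \<longleftrightarrow> y \<in> forward_orbit f x)
    \<and> (\<forall>x y. eta_type \<in> spectrum f x y)"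
proof -
  interpret transitive_system f using assms by unfold_locales auto
  have "eta_type \<in> total_spectrum f" using eta_in_spectrum by (auto simp: total_spectrum_def)
  moreover have "\<exists>M :: ('a \<times> 'a) set. comeagre M \<and>
         (\<forall>(x, y) \<in> M. \<forall>r :: nat rel.
            Linear_order r \<and> scattered r \<and> infinite (Field r) \<longrightarrow> order_type r \<in> spectrum f x y)"
    using comeagre_generic_pairs infinite_scattered_in_spectrum by (intro exI[of _ generic_pairs]) auto
  ultimately show ?thesis
    using scattered_in_total_spectrum eta_in_spectrum
      finite_type_imp_forward_orbit forward_orbit_imp_finite_type by (intro conjI allI impI) blast+
qed

end
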